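(* Let $f(x,y)=0$ be a reduced complex plane curve germ, with $f(0,0)=0$ and $f(0,y)\not\equiv 0$. Take a pseudo-ball $B$ of $T(f)$ such that $q(B)=\frac{L}{M}$ with $L,M$ coprime positive integers. Let $N$ be the index of $\lambda_B$. Write $\frac{d}{dz}F_B(z)=C'(z-z_1)\cdots(z-z_l)$ with $C'\neq0$, set $w_i=F_B(z_i)$ for $1\le i\le l$ and $I=\{i\in\{1,\dots,l\}: w_i\neq0\}$. Then $$\mathrm{in}_{\mathcal N}\,\mathcal D_{\overline B}(u,v)=\prod_{i\in I}\left(v^{M}-w_i^{M}u^{L}\right)^{N/M}.$$
   Context: Puiseux series: $\mathbf C\{x\}^*$ is the ring of convergent Puiseux series in $x$ with nonnegative exponents; a fractional power series is one of positive order. For $\alpha,\gamma\in\mathbf C\{x\}^*$, $O(\alpha,\gamma)=\mathrm{ord}(\alpha(x)-\gamma(x))$. $\mathrm{Zer}\, g$ is the set of Newton–Puiseux roots of $g$, i.e. fractional power series $\gamma$ with $g(x,\gamma(x))=0$. The index of a fractional power series $\beta$ is the smallest positive integer $N$ with $\beta\in\mathbf C\{x^{1/N}\}$. "$+\cdots$" means plus higher order terms. Write $f=u\prod_{i=1}^p[y-\alpha_i(x)]$, $\frac{\partial f}{\partial y}=\tilde u\prod_{j=1}^{p-1}[y-\gamma_j(x)]$ with $u,\tilde u$ units and $\alpha_i,\gamma_j$ fractional power series (the $\alpha_i$ are distinct, the $\gamma_j$ are listed with multiplicity). Tree model: for $\alpha\in\mathbf C\{x\}^*$ and rational $h>0$,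 the pseudo-ball is $B(\alpha,h)=\{\gamma\in\mathbf C\{x\}^*: O(\gamma,\alpha)\ge h\}$, of height $h(B)=h$. $T(f)=\{B(\alpha,O(\alpha,\alpha')):\alpha,\alpha'\in\mathrm{Zer} f,\ \alpha\ne\alpha'\}$. For $B\in T(f)$, $\lambda_B(x)$ is obtained from any $\alpha\in B$ by omitting all terms of order $\ge h(B)$. There are a polynomial $F_B(z)\in\mathbf C[z]$ (nonzero) and a rational number $q(B)$, determined by $f$ and $B$, such that for every $\gamma(x)=\lambda_B(x)+cx^{h(B)}+\cdots$ one has $f(x,\gamma(x))=F_B(c)x^{q(B)}+\cdots$. A root $\gamma_j$ leaves $T(f)$ at $B\in T(f)$ if $\gamma_j\in B$ and $h(B)=\max_i O(\alpha_i,\gamma_j)$. Conjugation: choose a positive integer $D$ such that all $\alpha_i,\gamma_j\in\mathbf C\{x^{1/D}\}$, and let $\mathbf U_D=\{\theta\in\mathbf C:\theta^D=1\}$ act by $\theta*\sum a_kx^{N_k/D}=\sum a_k\theta^{N_k}x^{N_k/D}$. It acts on $T(f)$ by $\theta*B(\alpha,h)=B(\theta*\alpha,h)$ ($\alpha\in\mathrm{Zer} f$); $\overline B$ denotes the orbit of $B$. Put $\mathcal D_B(u,v)=\prod_j(v-f(u,\gamma_j(u)))$, the product over all $j$ such that $\gamma_j$ leaves $T(f)$ at $B$, and $\mathcal D_{\overline B}=\prod_{B'\in\overline B}\mathcal D_{B'}$, which lies in $\mathbf C\{u\}[v]$. For $g=\sum a_{ij}u^iv^j\neq 0$, the Newton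 diagram is the convex hull of $\{(i,j):a_{ij}\neq0\}+\mathbf R_{\ge0}^2$, and $\mathrm{in}_{\mathcal N}g$ is the sum of the terms $a_{ij}u^iv^j$ with $(i,j)$ on a compact edge of it. The exponent $N/M$ is rational, possibly non-integer for individual factors; the product is understood as the rational power monic in $v$, i.e. the formula means that $\mathrm{in}_{\mathcal N}\mathcal D_{\overline B}(u,v)$ is monic in $v$ and $\bigl(\mathrm{in}_{\mathcal N}\mathcal D_{\overline B}(u,v)\bigr)^M=\prod_{i\in I}(v^M-w_i^Mu^L)^N$. *)

theory Defs
  imports
    "HOL-Analysis.Analysis"
    "HOL-Computational_Algebra.Computational_Algebra"
begin

section \<open>Puiseux series with nonnegative exponents\<close>

text \<open>
  The ring structure is set up on formal Puiseux series, given by their coefficient functions on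
  rational exponents; the convergent ones are singled out as a subset (\<open>CPuiseux\<close> below).
\<close>

typedef puiseux =
  "{a :: rat \<Rightarrow> complex. \<exists>D>0. \<forall>r. a r \<noteq> 0 \<longrightarrow> r * of_nat D \<in> \<nat>}"
  morphisms pcoeff Abs_puiseux
  by (rule exI[of _ "\<lambda>_. 0"]) auto

setup_lifting type_definition_puiseux

lemma puiseux_eqI: "(\<And>r. pcoeff a r = pcoeff b r) \<Longrightarrow> a = b"
  by transfer auto

lemma rat_Nats_mult: "r * of_nat D \<in> \<nat> \<Longrightarrow> r * of_nat (D * k) \<in> (\<nat> :: rat set)"
  by (metis Nats_mult mult.assoc of_nat_in_Nats of_nat_mult)

lemma rat_Nats_mult': "r * of_nat k \<in> \<nat> \<Longrightarrow> r * of_nat (D * k) \<in> (\<nat> :: rat set)"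
  by (metis rat_Nats_mult mult.commute)

text \<open>\<open>ramify D g\<close> is the series $g(x^{1/D})$ (for $D > 0$).\<close>

lift_definition ramify :: "nat \<Rightarrow> complex fps \<Rightarrow> puiseux" is
  "\<lambda>D g r. if 0 < D \<and> r * of_nat D \<in> \<nat> then fps_nth g (nat \<lfloor>r * of_nat D\<rfloor>) else 0"
proof -
  fix D :: nat and g :: "complex fps"
  show "\<exists>D'>0. \<forall>r::rat. (if 0 < D \<and> r * of_nat D \<in> \<nat> then fps_nth g (nat \<lfloor>r * of_nat D\<rfloor>) else 0)
      \<noteq> 0 \<longrightarrow> r * of_nat D' \<in> \<nat>"
    by (cases "D = 0") (force intro: exI[of _ D] exI[of _ 1])+
qed

instantiation puiseux :: "{zero, one, plus, minus, uminus, times}"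
begin

lift_definition zero_puiseux :: puiseux is "\<lambda>_. 0"
  by auto

lift_definition one_puiseux :: puiseux is "\<lambda>r. if r = 0 then 1 else 0"
  by (auto intro!: exI[of _ 1])

lift_definition plus_puiseux :: "puiseux \<Rightarrow> puiseux \<Rightarrow> puiseux" is "\<lambda>a b r. a r + b r"
proof -
  fix a b :: "rat \<Rightarrow> complex"
  assume "\<exists>D>0. \<forall>r. a r \<noteq> 0 \<longrightarrow> r * of_nat D \<in> \<nat>" "\<exists>D>0. \<forall>r. b r \<noteq> 0 \<longrightarrow> r * of_nat D \<in> \<nat>"
  then obtain D E where "D > 0" "E > 0" "\<And>r. a r \<noteq> 0 \<Longrightarrow> r * of_nat D \<in> \<nat>"
    "\<And>r. b r \<noteq> 0 \<Longrightarrow> r * of_nat E \<in> \<nat>" by blast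
  then show "\<exists>D>0. \<forall>r. a r + b r \<noteq> 0 \<longrightarrow> r * of_nat D \<in> \<nat>"
    by (intro exI[of _ "D * E"]) (metis add.right_neutral nat_0_less_mult_iff rat_Nats_mult rat_Nats_mult')
qed

lift_definition minus_puiseux :: "puiseux \<Rightarrow> puiseux \<Rightarrow> puiseux" is "\<lambda>a b r. a r - b r"
proof -
  fix a b :: "rat \<Rightarrow> complex"
  assume "\<exists>D>0. \<forall>r. a r \<noteq> 0 \<longrightarrow> r * of_nat D \<in> \<nat>" "\<exists>D>0. \<forall>r. b r \<noteq> 0 \<longrightarrow> r * of_nat D \<in> \<nat>"
  then obtain D E where "D > 0" "E > 0" "\<And>r. a r \<noteq> 0 \<Longrightarrow> r * of_nat D \<in> \<nat>"
    "\<And>r. b r \<noteq> 0 \<Longrightarrow> r * of_nat E \<in> \<nat>" by blast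
  then show "\<exists>D>0. \<forall>r. a r - b r \<noteq> 0 \<longrightarrow> r * of_nat D \<in> \<nat>"
    by (intro exI[of _ "D * E"]) (metis diff_zero nat_0_less_mult_iff rat_Nats_mult rat_Nats_mult')
qed

lift_definition uminus_puiseux :: "puiseux \<Rightarrow> puiseux" is "\<lambda>a r. - a r"
  by auto

lift_definition times_puiseux :: "puiseux \<Rightarrow> puiseux \<Rightarrow> puiseux" is
  "\<lambda>a b r. \<Sum>s | a s \<noteq> 0 \<and> b (r - s) \<noteq> 0. a s * b (r - s)"
proof -
  fix a b :: "rat \<Rightarrow> complex"
  assume "\<exists>D>0. \<forall>r. a r \<noteq> 0 \<longrightarrow> r * of_nat D \<in> \<nat>" "\<exists>D>0. \<forall>r. b r \<noteq> 0 \<longrightarrow> r * of_nat D \<in> \<nat>"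
  then obtain D E where DE: "D > 0" "E > 0" "\<And>r. a r \<noteq> 0 \<Longrightarrow> r * of_nat D \<in> \<nat>"
    "\<And>r. b r \<noteq> 0 \<Longrightarrow> r * of_nat E \<in> \<nat>" by blast
  have "r * of_nat (D * E) \<in> \<nat>"
    if nz: "(\<Sum>s | a s \<noteq> 0 \<and> b (r - s) \<noteq> 0. a s * b (r - s)) \<noteq> 0" for r
  proof -
    obtain s where "a s \<noteq> 0" "b (r - s) \<noteq> 0"
      by (rule sum.not_neutral_contains_not_neutral[OF nz]) auto
    then have "s * of_nat (D * E) \<in> \<nat>" "(r - s) * of_nat (D * E) \<in> \<nat>"
      using DE rat_Nats_mult rat_Nats_mult' by blast+
    from Nats_add[OF this] show ?thesis by (simp add: algebra_simps)
  qed
  then show "\<exists>D>0. \<forall>r. (\<Sum>s | a s \<noteq> 0 \<and> b (r - s) \<noteq> 0. a s * b (r - s)) \<noteq> 0 \<longrightarrow> r * of_nat D \<in> \<nat>"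
    using DE by (intro exI[of _ "D * E"]) auto
qed

instance ..

end

lemma pcoeff_ramify_of_nat [simp]: "D > 0 \<Longrightarrow> pcoeff (ramify D g) (of_nat n / of_nat D) = fps_nth g n"
  by transfer auto

lemma pcoeff_ramify_0: "r * of_nat D \<notin> \<nat> \<Longrightarrow> pcoeff (ramify D g) r = 0"
  by transfer auto

lemma rat_Nats_cases:
  assumes "r * of_nat D \<in> (\<nat> :: rat set)" "D > 0"
  obtains n where "r = of_nat n / of_nat D"
  using assms by (auto elim!: Nats_cases simp: field_simps)

lemma ramify_eqI:
  assumes "D > 0" "\<And>r. pcoeff a r \<noteq> 0 \<Longrightarrow> r * of_nat D \<in> \<nat>"
    "\<And>n. pcoeff a (of_nat n / of_nat D) = fps_nth g n"
  shows "a = ramify D g"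
  using assms by (intro puiseux_eqI) (metis pcoeff_ramify_0 pcoeff_ramify_of_nat rat_Nats_cases)

lemma ramify_exists_support:
  assumes "D > 0" "\<And>r. pcoeff a r \<noteq> 0 \<Longrightarrow> r * of_nat D \<in> \<nat>"
  shows "\<exists>g. a = ramify D g"
  using assms by (intro exI[of _ "Abs_fps (\<lambda>n. pcoeff a (of_nat n / of_nat D))"] ramify_eqI) auto

lemma puiseux_support: "\<exists>D>0. \<forall>r. pcoeff a r \<noteq> 0 \<longrightarrow> r * of_nat D \<in> \<nat>"
  by transfer auto

lemma ramify_common:
  "\<exists>D>0. \<exists>g h k. a = ramify D g \<and> b = ramify D h \<and> c = ramify D k"
proof -
  obtain D E G where *: "D > 0" "E > 0" "G > 0"
    "\<And>r. pcoeff a r \<noteq> 0 \<Longrightarrow> r * of_nat D \<in> \<nat>"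
    "\<And>r. pcoeff b r \<noteq> 0 \<Longrightarrow> r * of_nat E \<in> \<nat>"
    "\<And>r. pcoeff c r \<noteq> 0 \<Longrightarrow> r * of_nat G \<in> \<nat>"
    using puiseux_support[of a] puiseux_support[of b] puiseux_support[of c] by blast
  then have "\<exists>g. a = ramify (D * E * G) g" "\<exists>g. b = ramify (D * E * G) g" "\<exists>g. c = ramify (D * E * G) g"
    by (intro ramify_exists_support; metis nat_0_less_mult_iff rat_Nats_mult rat_Nats_mult')+
  then show ?thesis using * by (metis nat_0_less_mult_iff)
qed

lemma ramify_mult:
  assumes D: "D > 0"
  shows "ramify D g * ramify D h = ramify D (g * h)"
proof (rule ramify_eqI[OF D])
  have supp: "s * of_nat D \<in> \<nat>" if "pcoeff (ramify D k) s \<noteq> 0" for s k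
    using that pcoeff_ramify_0 by blast
  fix r assume "pcoeff (ramify D g * ramify D h) r \<noteq> 0"
  then obtain s where "pcoeff (ramify D g) s \<noteq> 0" "pcoeff (ramify D h) (r - s) \<noteq> 0"
    by (metis (mono_tags, lifting) mem_Collect_eq sum.neutral times_puiseux.rep_eq)
  from Nats_add[OF this[THEN supp]] show "r * of_nat D \<in> \<nat>" by (simp add: algebra_simps)
next
  have supp: "s * of_nat D \<in> \<nat>" if "pcoeff (ramify D k) s \<noteq> 0" for s k
    using that pcoeff_ramify_0 by blast
  fix n
  let ?e = "\<lambda>i. of_nat i / of_nat D :: rat"
  let ?t = "\<lambda>s. pcoeff (ramify D g) s * pcoeff (ramify D h) (?e n - s)"
  have diff: "?e n - ?e i = ?e (n - i)" if "i \<le> n" for i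
    using that D by (simp add: of_nat_diff diff_divide_distrib)
  have sub: "{s. pcoeff (ramify D g) s \<noteq> 0 \<and> pcoeff (ramify D h) (?e n - s) \<noteq> 0} \<subseteq> ?e ` {0..n}"
  proof
    fix s assume s: "s \<in> {s. pcoeff (ramify D g) s \<noteq> 0 \<and> pcoeff (ramify D h) (?e n - s) \<noteq> 0}"
    then obtain i where i: "s = ?e i" using D supp rat_Nats_cases by blast
    from s obtain j where j: "?e n - s = ?e j" using D supp rat_Nats_cases by blast
    have "(of_nat n :: rat) = of_nat (i + j)" using i j D by (simp add: field_simps)
    then have "n = i + j" by (simp only: of_nat_eq_iff)
    then show "s \<in> ?e ` {0..n}" using i by auto
  qed
  have inj: "inj_on ?e {0..n}" using D by (auto simp: inj_on_def)
  have "pcoeff (ramify D g * ramify D h) (?e n) = sum ?t (?e ` {0..n})"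
    unfolding times_puiseux.rep_eq by (rule sum.mono_neutral_left) (use sub in auto)
  also have "\<dots> = (\<Sum>i=0..n. ?t (?e i))" using inj by (simp add: sum.reindex)
  also have "\<dots> = (\<Sum>i=0..n. fps_nth g i * fps_nth h (n - i))"
    using D by (intro sum.cong refl) (simp add: diff del: of_nat_diff)
  finally show "pcoeff (ramify D g * ramify D h) (?e n) = fps_nth (g * h) n"
    by (simp add: fps_mult_nth)
qed

lemma ramify_add: "ramify D g + ramify D h = ramify D (g + h)"
  and ramify_diff: "ramify D g - ramify D h = ramify D (g - h)"
  and ramify_uminus: "- ramify D g = ramify D (- g)"
  and ramify_0: "ramify D 0 = 0"
  by (transfer; fastforce)+

lemma ramify_1: "D > 0 \<Longrightarrow> ramify D 1 = 1"
proof (rule sym, rule ramify_eqI)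
  show "pcoeff 1 r \<noteq> 0 \<Longrightarrow> r * of_nat D \<in> \<nat>" for r
    by transfer (auto split: if_splits)
  show "D > 0 \<Longrightarrow> pcoeff 1 (of_nat n / of_nat D) = fps_nth 1 n" for n
    by transfer auto
qed

lemma ramify_inject: "D > 0 \<Longrightarrow> ramify D g = ramify D h \<longleftrightarrow> g = h"
  by (metis fps_ext pcoeff_ramify_of_nat)

instance puiseux :: idom
proof intro_classes
  fix a b c :: puiseux
  obtain D g h k where [simp]: "D > 0" "a = ramify D g" "b = ramify D h" "c = ramify D k"
    using ramify_common[of a b c] by blast
  note rs = ramify_mult ramify_add ramify_diff ramify_uminus
  show "a * b * c = a * (b * c)" "a * b = b * a" "a + b + c = a + (b + c)" "a + b = b + a"
    "(a + b) * c = a * c + b * c" "a * (b + c) = a * b + a * c"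
    by (simp_all add: rs algebra_simps)
  show "1 * a = a" by (simp add: rs flip: ramify_1[of D])
  show "0 * a = 0" "a * 0 = 0" by (simp_all add: rs flip: ramify_0[of D])
  show "0 + a = a" by (simp add: rs flip: ramify_0[of D])
  show "- a + a = 0" by (simp add: rs ramify_0)
  show "a - b = a + - b" by (simp add: rs)
  show "(0::puiseux) \<noteq> 1" by (simp add: ramify_inject flip: ramify_0[of D] ramify_1[of D])
  show "a * b \<noteq> 0" if "a \<noteq> 0" "b \<noteq> 0"
    using that by (simp add: rs ramify_inject flip: ramify_0[of D])
qed

text \<open>The order of a series, with $\mathrm{ord}\,0 = \infty$.\<close>

definition porder :: "puiseux \<Rightarrow> ereal" where
  "porder a = (if a = 0 then \<infinity> else ereal (real_of_rat (LEAST r. pcoeff a r \<noteq> 0)))"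

definition contact :: "puiseux \<Rightarrow> puiseux \<Rightarrow> ereal" where
  "contact a b = porder (a - b)"

text \<open>\<open>starts_with a c q\<close> expresses $a = c\,x^q + \cdots$; the coefficient $c$ may vanish.\<close>

definition starts_with :: "puiseux \<Rightarrow> complex \<Rightarrow> rat \<Rightarrow> bool" where
  "starts_with a c q \<longleftrightarrow> (\<forall>r<q. pcoeff a r = 0) \<and> pcoeff a q = c"

lift_definition prestrict :: "rat set \<Rightarrow> puiseux \<Rightarrow> puiseux" is
  "\<lambda>S a r. if r \<in> S then a r else 0"
  by auto

definition of_fps :: "complex fps \<Rightarrow> puiseux" where
  "of_fps g = ramify 1 g"

subsection \<open>Convergent series\<close>

text \<open>\<open>CPuiseux_ram D\<close> is $\mathbf C\{x^{1/D}\}$ and \<open>CPuiseux\<close> is $\mathbf C\{x\}^*$.\<close>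

definition CPuiseux_ram :: "nat \<Rightarrow> puiseux set" where
  "CPuiseux_ram D = ramify D ` {g. fps_conv_radius g > 0}"

definition CPuiseux :: "puiseux set" where
  "CPuiseux = (\<Union>D\<in>{0<..}. CPuiseux_ram D)"

definition frac_series :: "puiseux set" where
  "frac_series = {a \<in> CPuiseux. porder a > 0}"

definition pindex :: "puiseux \<Rightarrow> nat" where
  "pindex a = (LEAST N. N > 0 \<and> a \<in> CPuiseux_ram N)"

section \<open>Convergent power series in two variables\<close>

text \<open>
  A power series $f(x,y)$ is an element of $\mathbf C[[x]][[y]]$: the outer variable is $y$, and
  $f = \sum_{i,j} f_{ij} x^i y^j$ with $f_{ij}$ = \<open>fps_nth (fps_nth f j) i\<close>. Thus \<open>fps_deriv\<close> is
  $\partial/\partial y$.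
\<close>

definition C2 :: "complex fps fps set" where
  "C2 = {f. \<exists>r>0. (\<lambda>(i, j). norm (fps_nth (fps_nth f j) i) * r ^ (i + j)) summable_on UNIV}"

definition unit_C2 :: "complex fps fps \<Rightarrow> bool" where
  "unit_C2 g \<longleftrightarrow> g \<in> C2 \<and> (\<exists>h\<in>C2. g * h = 1)"

definition reduced_C2 :: "complex fps fps \<Rightarrow> bool" where
  "reduced_C2 f \<longleftrightarrow> f \<noteq> 0 \<and> (\<forall>g\<in>C2. \<forall>h\<in>C2. f = g ^ 2 * h \<longrightarrow> unit_C2 g)"

definition lift_y :: "complex fps fps \<Rightarrow> puiseux fps" where
  "lift_y f = Abs_fps (\<lambda>j. of_fps (fps_nth f j))"

text \<open>
  \<open>psubst f a\<close> is $f(x, a(x)) = \sum_j f_j(x)\,a(x)^j$, formed coefficientwise. If $a$ has positive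
  order, only finitely many $j$ contribute to each coefficient; other $a$ are not meant.
\<close>

definition psubst :: "complex fps fps \<Rightarrow> puiseux \<Rightarrow> puiseux" where
  "psubst f a = Abs_puiseux (\<lambda>r. \<Sum>j | pcoeff (of_fps (fps_nth f j) * a ^ j) r \<noteq> 0.
     pcoeff (of_fps (fps_nth f j) * a ^ j) r)"

lemma ramify_power: "D > 0 \<Longrightarrow> ramify D g ^ j = ramify D (g ^ j)"
  by (induction j) (simp_all add: ramify_1 ramify_mult)

lemma of_fps_ramify: "D > 0 \<Longrightarrow> \<exists>h. of_fps g = ramify D h"
  unfolding of_fps_def
  by (rule ramify_exists_support) (metis mult_1 pcoeff_ramify_0 rat_Nats_mult)+

lemma pcoeff_psubst:
  "pcoeff (psubst f a) r = (\<Sum>j | pcoeff (of_fps (fps_nth f j) * a ^ j) r \<noteq> 0.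
     pcoeff (of_fps (fps_nth f j) * a ^ j) r)"
proof -
  obtain D g where D: "D > 0" "a = ramify D g"
    using ramify_common[of a a a] by blast
  have "s * of_nat D \<in> \<nat>" if "pcoeff (of_fps (fps_nth f j) * a ^ j) s \<noteq> 0" for s j
  proof -
    obtain h where "of_fps (fps_nth f j) = ramify D h" using of_fps_ramify D(1) by blast
    then show ?thesis using that D pcoeff_ramify_0 by (metis ramify_mult ramify_power)
  qed
  then have "\<exists>D>0. \<forall>s. (\<Sum>j | pcoeff (of_fps (fps_nth f j) * a ^ j) s \<noteq> 0.
     pcoeff (of_fps (fps_nth f j) * a ^ j) s) \<noteq> 0 \<longrightarrow> s * of_nat D \<in> \<nat>"
    using D(1) by (metis (mono_tags, lifting) mem_Collect_eq sum.neutral)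
  then show ?thesis by (simp add: psubst_def Abs_puiseux_inverse)
qed

definition Zer :: "complex fps fps \<Rightarrow> puiseux set" where
  "Zer g = {a \<in> frac_series. psubst g a = 0}"

section \<open>The tree model\<close>

definition pball :: "puiseux \<Rightarrow> rat \<Rightarrow> puiseux set" where
  "pball a h = {b \<in> CPuiseux. contact b a \<ge> ereal (real_of_rat h)}"

text \<open>
  The height is determined by the ball as a set: \<open>pball a h\<close> contains $a + x^h$, but nothing
  whose difference from $a$ has smaller order.
\<close>

definition height :: "puiseux set \<Rightarrow> rat" where
  "height B = (THE h. h > 0 \<and> (\<exists>a\<in>CPuiseux. B = pball a h))"

definition Tree :: "complex fps fps \<Rightarrow> puiseux set set" where
  "Tree f = {pball a h | a a' h. a \<in> Zer f \<and> a' \<in> Zer f \<and> a \<noteq> a' \<and>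
     contact a a' = ereal (real_of_rat h)}"

definition lambda :: "puiseux set \<Rightarrow> puiseux" where
  "lambda B = (THE l. \<forall>a\<in>B. l = prestrict {..<height B} a)"

text \<open>
  \<open>is_FB f B F q\<close> is the property characterising $(F_B, q(B))$. It fixes $q$ because
  $F \neq 0$ takes a nonzero value at some $c$, and then $F$ through its values.
\<close>

definition is_FB :: "complex fps fps \<Rightarrow> puiseux set \<Rightarrow> complex poly \<Rightarrow> rat \<Rightarrow> bool" where
  "is_FB f B F q \<longleftrightarrow> F \<noteq> 0 \<and>
     (\<forall>b\<in>CPuiseux. \<forall>c. starts_with (b - lambda B) c (height B) \<longrightarrow>
        starts_with (psubst f b) (poly F c) q)"

definition FB :: "complex fps fps \<Rightarrow> puiseux set \<Rightarrow> complex poly" where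
  "FB f B = (THE F. \<exists>q. is_FB f B F q)"

definition qB :: "complex fps fps \<Rightarrow> puiseux set \<Rightarrow> rat" where
  "qB f B = (THE q. \<exists>F. is_FB f B F q)"

definition leaves_at :: "complex fps fps \<Rightarrow> puiseux \<Rightarrow> puiseux set \<Rightarrow> bool" where
  "leaves_at f c B \<longleftrightarrow> B \<in> Tree f \<and> c \<in> B \<and>
     ereal (real_of_rat (height B)) = Max ((\<lambda>a. contact a c) ` Zer f)"

section \<open>Conjugation and discriminant factors\<close>

text \<open>The action of $\theta\in\mathbf U_D$; meaningful only on series in $x^{1/D}$.\<close>

lift_definition pconj :: "nat \<Rightarrow> complex \<Rightarrow> puiseux \<Rightarrow> puiseux" is
  "\<lambda>D \<theta> a r. a r * \<theta> ^ nat \<lfloor>r * of_nat D\<rfloor>"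
  by (metis mult_zero_left)

text \<open>
  The action on balls is through centres in \<open>Zer f\<close>: a ball also contains series outside
  $\mathbf C\{x^{1/D}\}$, so it is not the elementwise image.
\<close>

definition ball_orbit :: "nat \<Rightarrow> complex fps fps \<Rightarrow> puiseux set \<Rightarrow> puiseux set set" where
  "ball_orbit D f B = {pball (pconj D \<theta> a) h | \<theta> a h.
     \<theta> ^ D = 1 \<and> a \<in> Zer f \<and> h > 0 \<and> B = pball a h}"

text \<open>
  Polynomials in $v$ with Puiseux series in $u$ as coefficients; \<open>n\<close> is the number of the roots
  $\gamma_1,\dots,\gamma_n$ of $\partial f/\partial y$.
\<close>

definition disc_factor ::
    "complex fps fps \<Rightarrow> nat \<Rightarrow> (nat \<Rightarrow> puiseux) \<Rightarrow> puiseux set \<Rightarrow> puiseux poly" where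
  "disc_factor f n \<gamma> B = (\<Prod>j | j \<in> {1..n} \<and> leaves_at f (\<gamma> j) B. [:- psubst f (\<gamma> j), 1:])"

definition disc_orbit ::
    "nat \<Rightarrow> complex fps fps \<Rightarrow> nat \<Rightarrow> (nat \<Rightarrow> puiseux) \<Rightarrow> puiseux set \<Rightarrow> puiseux poly" where
  "disc_orbit D f n \<gamma> B = (\<Prod>B'\<in>ball_orbit D f B. disc_factor f n \<gamma> B')"

section \<open>Newton diagrams\<close>

text \<open>
  For $g = \sum a_{ij} u^i v^j$, with $a_{ij}$ = \<open>pcoeff (coeff g j) i\<close>; the exponents $i$ of $u$ are
  allowed to be rational, which for $g\in\mathbf C\{u\}[v]$ gives the usual notions.
\<close>

definition newton_diagram :: "puiseux poly \<Rightarrow> (real \<times> real) set" where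
  "newton_diagram g = convex hull
     {(real_of_rat i + s, real j + t) | i j s t. pcoeff (coeff g j) i \<noteq> 0 \<and> s \<ge> 0 \<and> t \<ge> 0}"

definition compact_edge_points :: "puiseux poly \<Rightarrow> (real \<times> real) set" where
  "compact_edge_points g = \<Union>{E. E edge_of newton_diagram g \<and> compact E}"

definition newton_initial :: "puiseux poly \<Rightarrow> puiseux poly" where
  "newton_initial g = (\<Sum>j\<le>degree g.
     monom (prestrict {i. (real_of_rat i, real j) \<in> compact_edge_points g} (coeff g j)) j)"

end

theory Submission
  imports Defs
begin

text \<open>
  From the factorisations of $f$ and $\partial f/\partial y$ one reads off, for
  $b = \lambda_B + c x^{h(B)} + \cdots$, the initial terms of $f(x, b)$ and, by the product rule,
  of $\partial f/\partial y(x, b)$; the latter is $F_B'(c)\, x^{q(B) - h(B)}$. Hence the leading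
  coefficients at $x^{h(B)}$ of the $\gamma_j \in B$ are the roots of $F_B'$, with multiplicity, and
  $\gamma_j$ leaves at $B$ iff its coefficient is not a root of $F_B$. So the initial form of
  $\mathcal D_B$ is $\prod_{i \in I} (v - w_i u^{q(B)})$, and conjugating $B$ by $\theta$ replaces
  $w_i$ by $\theta^{q(B) D} w_i$. Multiplying over all $\theta \in \mathbf U_D$ gives
  $\prod_{i\in I} (v^M - w_i^M u^L)^{D/M}$, while every ball of the orbit is hit $D/N$ times. The
  formula follows since a monic polynomial is determined by its powers.
\<close>

section \<open>Formal Puiseux series\<close>

text \<open>Two difficulties shape the argument. First, nothing says which \<open>\<gamma> j\<close>
  is conjugate to which. They are never matched: for every ball of the orbit, the derivative of its
  \<open>FB\<close> is factored once by the coefficients of the \<open>\<gamma> j\<close> in that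
  ball and once by the rotated z_i. Both families then agree as multisets, and only values of
  \<open>FB\<close> at them matter. Second, N/M need not be an integer, so no fractional power is
  formed. Since q(B) D is an integer, M divides D; put s = D/M. If P is the product of the factors v
  - (leading value) over the orbit and S is the product of the v^M - w_i^M, the count over all
  \<theta> reads P^(D/N) = S^s. Raising it to the power N and removing the exponent s gives P^M =
  S^N. The passage to two variables is uniform because all these values of f have the same order
  q(B) and nonzero leading coefficient: the Newton diagram has one compact edge, and the initial
  form is the weighted homogenisation of P. This requires at least one factor, since the constant 1
  has no compact edge. A factor exists because F_B has two distinct roots and hence a critical point
  that is not a root.\<close>

lemma pcoeff_0 [simp]: "pcoeff 0 r = 0"
  by transfer auto

lemma pcoeff_1: "pcoeff 1 r = (if r = 0 then 1 else 0)"
  by transfer auto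

lemma pcoeff_add [simp]: "pcoeff (a + b) r = pcoeff a r + pcoeff b r"
  by transfer auto

lemma pcoeff_diff [simp]: "pcoeff (a - b) r = pcoeff a r - pcoeff b r"
  by transfer auto

lemma pcoeff_uminus [simp]: "pcoeff (- a) r = - pcoeff a r"
  by transfer auto

lemma pcoeff_sum [simp]: "pcoeff (\<Sum>i\<in>A. g i) r = (\<Sum>i\<in>A. pcoeff (g i) r)"
  by (induction A rule: infinite_finite_induct) auto

lemma pcoeff_prestrict [simp]: "pcoeff (prestrict S a) r = (if r \<in> S then pcoeff a r else 0)"
  by transfer auto

text \<open>The formal part of \<open>CPuiseux_ram D\<close>, without convergence. It makes
  \<open>r * of_nat D\<close> a natural number wherever \<open>pconj D\<close> takes a
  floor.\<close>

definition psupp :: "nat \<Rightarrow> puiseux \<Rightarrow> bool" where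
  "psupp D a \<longleftrightarrow> (\<forall>r. pcoeff a r \<noteq> 0 \<longrightarrow> r * of_nat D \<in> \<nat>)"

lemma psupp_exists: obtains D where "D > 0" "psupp D a"
  using puiseux_support[of a] by (auto simp: psupp_def)

lemma psupp_ramify: "psupp D (ramify D g)"
  using pcoeff_ramify_0 by (auto simp: psupp_def)

lemma psupp_imp_ramify: "D > 0 \<Longrightarrow> psupp D a \<Longrightarrow> \<exists>g. a = ramify D g"
  using ramify_exists_support by (auto simp: psupp_def)

lemma psupp_mult: "D > 0 \<Longrightarrow> psupp D a \<Longrightarrow> psupp D b \<Longrightarrow> psupp D (a * b)"
  by (metis psupp_imp_ramify psupp_ramify ramify_mult)

lemma psupp_power: "D > 0 \<Longrightarrow> psupp D a \<Longrightarrow> psupp D (a ^ j)"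
  by (metis psupp_imp_ramify psupp_ramify ramify_power)

lemma psupp_add: "psupp D a \<Longrightarrow> psupp D b \<Longrightarrow> psupp D (a + b)"
  by (auto simp: psupp_def) (metis add.right_neutral)

lemma psupp_of_fps: "D > 0 \<Longrightarrow> psupp D (of_fps g)"
  by (metis of_fps_ramify psupp_ramify)

lemma psupp_prestrict: "psupp D a \<Longrightarrow> psupp D (prestrict S a)"
  by (auto simp: psupp_def)

lemma CPuiseux_ram_imp_psupp: "a \<in> CPuiseux_ram D \<Longrightarrow> psupp D a"
  by (auto simp: CPuiseux_ram_def psupp_ramify)

lemma rat_Nats_ge_0: "r * of_nat D \<in> \<nat> \<Longrightarrow> D > 0 \<Longrightarrow> r \<ge> (0::rat)"
  by (metis divide_nonneg_nonneg of_nat_0_le_iff rat_Nats_cases)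

lemma pcoeff_neg: "r < 0 \<Longrightarrow> pcoeff a r = 0"
proof -
  assume "r < 0"
  obtain D where "D > 0" "psupp D a" by (rule psupp_exists)
  then show ?thesis using \<open>r < 0\<close> rat_Nats_ge_0[of r D] by (auto simp: psupp_def)
qed

lemma finite_bounded_Nats:
  assumes "D > 0"
  shows "finite {r::rat. r * of_nat D \<in> \<nat> \<and> r \<le> h}"
proof (rule finite_subset)
  show "{r. r * of_nat D \<in> \<nat> \<and> r \<le> h} \<subseteq> (\<lambda>n. of_nat n / of_nat D) ` {..nat \<lfloor>h * of_nat D\<rfloor>}"
  proof
    fix r assume r: "r \<in> {r. r * of_nat D \<in> \<nat> \<and> r \<le> h}"
    then obtain n where n: "r = of_nat n / of_nat D" using assms rat_Nats_cases by blast
    with r assms have "of_nat n \<le> h * of_nat D" by (simp add: field_simps)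
    then have "int n \<le> \<lfloor>h * of_nat D\<rfloor>" by (simp add: le_floor_iff)
    then have "n \<le> nat \<lfloor>h * of_nat D\<rfloor>" by linarith
    with n show "r \<in> (\<lambda>n. of_nat n / of_nat D) ` {..nat \<lfloor>h * of_nat D\<rfloor>}" by auto
  qed
qed auto

lemma finite_pcoeff_le: "finite {r. pcoeff a r \<noteq> 0 \<and> r \<le> h}"
proof -
  obtain D where D: "D > 0" "psupp D a" by (rule psupp_exists)
  show ?thesis
    by (rule finite_subset[OF _ finite_bounded_Nats[OF D(1), of h]])
       (use D in \<open>auto simp: psupp_def\<close>)
qed

text \<open>The rationals are not well-ordered, but below any bound only finitely many exponents
  occur, so a minimum exists. The \<open>LEAST\<close> in \<open>porder\<close> and in
  \<open>local_exp\<close> rests on this.\<close>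

lemma pcoeff_least:
  assumes "a \<noteq> 0"
  obtains q where "pcoeff a q \<noteq> 0" "\<And>r. r < q \<Longrightarrow> pcoeff a r = 0"
proof -
  obtain s where s: "pcoeff a s \<noteq> 0" using assms puiseux_eqI[of a 0] by auto
  let ?S = "{r. pcoeff a r \<noteq> 0 \<and> r \<le> s}"
  have fin: "finite ?S" by (rule finite_pcoeff_le)
  have ne: "?S \<noteq> {}" using s by auto
  have "Min ?S \<in> ?S" using fin ne by (rule Min_in)
  moreover have "pcoeff a r = 0" if "r < Min ?S" for r
  proof (rule ccontr)
    assume "pcoeff a r \<noteq> 0"
    moreover have "r \<le> s" using that \<open>Min ?S \<in> ?S\<close> by auto
    ultimately have "Min ?S \<le> r" using fin by (intro Min_le) auto
    with that show False by simp
  qed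
  ultimately show ?thesis using that[of "Min ?S"] by blast
qed

lemma porder_eqI:
  assumes "pcoeff a q \<noteq> 0" "\<And>r. r < q \<Longrightarrow> pcoeff a r = 0"
  shows "porder a = ereal (real_of_rat q)"
proof -
  have "(LEAST r. pcoeff a r \<noteq> 0) = q"
    by (rule Least_equality) (use assms in \<open>auto simp: not_less[symmetric]\<close>)
  moreover have "a \<noteq> 0" using assms by auto
  ultimately show ?thesis by (simp add: porder_def)
qed

lemma porder_0 [simp]: "porder 0 = \<infinity>"
  by (simp add: porder_def)

lemma porder_ge_iff: "porder a \<ge> ereal (real_of_rat h) \<longleftrightarrow> (\<forall>r<h. pcoeff a r = 0)"
proof (cases "a = 0")
  case False
  then obtain q where q: "pcoeff a q \<noteq> 0" "\<And>r. r < q \<Longrightarrow> pcoeff a r = 0"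
    using pcoeff_least by blast
  then have "porder a = ereal (real_of_rat q)" by (rule porder_eqI)
  then have "porder a \<ge> ereal (real_of_rat h) \<longleftrightarrow> h \<le> q" by (simp add: of_rat_less_eq)
  also have "\<dots> \<longleftrightarrow> (\<forall>r<h. pcoeff a r = 0)"
    using q by (meson less_le_trans not_le)
  finally show ?thesis .
qed auto

lemma porder_gt_iff: "porder a > ereal (real_of_rat h) \<longleftrightarrow> (\<forall>r\<le>h. pcoeff a r = 0)"
proof (cases "a = 0")
  case False
  then obtain q where q: "pcoeff a q \<noteq> 0" "\<And>r. r < q \<Longrightarrow> pcoeff a r = 0"
    using pcoeff_least by blast
  then have "porder a = ereal (real_of_rat q)" by (rule porder_eqI)
  then have "porder a > ereal (real_of_rat h) \<longleftrightarrow> h < q" by (simp add: of_rat_less)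
  also have "\<dots> \<longleftrightarrow> (\<forall>r\<le>h. pcoeff a r = 0)"
    using q by (meson le_less_trans not_le)
  finally show ?thesis .
qed auto

lemma porder_eq_iff:
  "porder a = ereal (real_of_rat h) \<longleftrightarrow> pcoeff a h \<noteq> 0 \<and> (\<forall>r<h. pcoeff a r = 0)"
proof
  assume "porder a = ereal (real_of_rat h)"
  then have "porder a \<ge> ereal (real_of_rat h)" "\<not> porder a > ereal (real_of_rat h)" by auto
  then show "pcoeff a h \<noteq> 0 \<and> (\<forall>r<h. pcoeff a r = 0)"
    unfolding porder_ge_iff porder_gt_iff by (metis order_le_less)
qed (use porder_eqI in blast)

lemma porder_pos_iff: "porder a > 0 \<longleftrightarrow> pcoeff a 0 = 0"
  using porder_gt_iff[of 0 a] pcoeff_neg[of _ a] by (auto simp: zero_ereal_def order_le_less)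

lemma frac_series_iff: "a \<in> frac_series \<longleftrightarrow> a \<in> CPuiseux \<and> pcoeff a 0 = 0"
  by (simp add: frac_series_def porder_pos_iff)

section \<open>Arithmetic of initial terms\<close>

lemma starts_with_pcoeff: "starts_with a c q \<Longrightarrow> pcoeff a q = c"
  by (simp add: starts_with_def)

text \<open>With coefficient zero, \<open>starts_with\<close> only bounds the order from below, so
  exponents can be compared only when both coefficients are nonzero.\<close>

lemma starts_with_unique:
  assumes "starts_with a c q" "starts_with a d q'" "c \<noteq> 0" "d \<noteq> 0"
  shows "q = q' \<and> c = d"
  using assms unfolding starts_with_def by (metis linorder_neqE)

lemma starts_with_less: "starts_with a c q \<Longrightarrow> q' < q \<Longrightarrow> starts_with a 0 q'"
  by (auto simp: starts_with_def)

lemma starts_with_zero [simp]: "starts_with 0 0 q"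
  by (auto simp: starts_with_def)

lemma starts_with_one: "starts_with 1 1 0"
  by (auto simp: starts_with_def pcoeff_1)

lemma starts_with_add: "starts_with a c q \<Longrightarrow> starts_with b d q \<Longrightarrow> starts_with (a + b) (c + d) q"
  by (auto simp: starts_with_def)

lemma starts_with_minus: "starts_with a c q \<Longrightarrow> starts_with (- a) (- c) q"
  by (auto simp: starts_with_def)

lemma starts_with_sum:
  "(\<And>i. i \<in> A \<Longrightarrow> starts_with (g i) (c i) q) \<Longrightarrow> starts_with (\<Sum>i\<in>A. g i) (\<Sum>i\<in>A. c i) q"
  by (auto simp: starts_with_def)

lemma starts_with_mult:
  assumes "starts_with a c q" "starts_with b d r"
  shows "starts_with (a * b) (c * d) (q + r)"
  unfolding starts_with_def
proof (intro conjI allI impI)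
  have ord: "q \<le> s" "r \<le> t" if "pcoeff a s \<noteq> 0" "pcoeff b t \<noteq> 0" for s t
    using that assms by (auto simp: starts_with_def not_less[symmetric])
  fix t assume "t < q + r"
  then have *: "{s. pcoeff a s \<noteq> 0 \<and> pcoeff b (t - s) \<noteq> 0} = {}"
    using ord by (force simp: algebra_simps)
  show "pcoeff (a * b) t = 0"
    unfolding times_puiseux.rep_eq * by simp
next
  have ord: "q \<le> s" "r \<le> t" if "pcoeff a s \<noteq> 0" "pcoeff b t \<noteq> 0" for s t
    using that assms by (auto simp: starts_with_def not_less[symmetric])
  have "pcoeff (a * b) (q + r) = (\<Sum>s\<in>{q}. pcoeff a s * pcoeff b (q + r - s))"
    unfolding times_puiseux.rep_eq
  proof (rule sum.mono_neutral_left)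
    show "{s. pcoeff a s \<noteq> 0 \<and> pcoeff b (q + r - s) \<noteq> 0} \<subseteq> {q}"
    proof clarify
      fix s assume "pcoeff a s \<noteq> 0" "pcoeff b (q + r - s) \<noteq> 0"
      from ord[OF this] show "s = q" by simp
    qed
  qed auto
  then show "pcoeff (a * b) (q + r) = c * d" using assms by (simp add: starts_with_def)
qed

lemma starts_with_prod:
  "(\<And>i. i \<in> A \<Longrightarrow> starts_with (g i) (c i) (q i)) \<Longrightarrow>
    starts_with (\<Prod>i\<in>A. g i) (\<Prod>i\<in>A. c i) (\<Sum>i\<in>A. q i)"
  by (induction A rule: infinite_finite_induct) (auto simp: starts_with_one intro: starts_with_mult)

lemma starts_with_const_coeff: "starts_with a (pcoeff a 0) 0"
  by (auto simp: starts_with_def pcoeff_neg)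

text \<open>All exponents are nonnegative, so an arbitrary factor keeps the exponent and acts
  through its constant term. It is applied to units evaluated along a series and, with c = 0, to
  their derivatives.\<close>

lemma starts_with_mult_0: "starts_with b c r \<Longrightarrow> starts_with (a * b) (pcoeff a 0 * c) r"
  using starts_with_mult[OF starts_with_const_coeff] by fastforce

section \<open>Monomials and series with finite support\<close>

lift_definition pmonom :: "complex \<Rightarrow> rat \<Rightarrow> puiseux" is
  "\<lambda>c r s. if s = r \<and> r \<ge> 0 then c else 0"
proof -
  fix c :: complex and r :: rat
  obtain a b where ab: "quotient_of r = (a, b)" by (cases "quotient_of r")
  then have r: "r = of_int a / of_int b" "b > 0"
    by (simp_all add: quotient_of_div quotient_of_denom_pos)
  have "r * of_nat (nat b) \<in> \<nat>" if "r \<ge> 0"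
  proof -
    have "r * of_nat (nat b) = of_int a" using r by simp
    moreover have "a \<ge> 0" using that r by (simp add: zero_le_divide_iff)
    ultimately show ?thesis by (metis of_int_of_nat_eq of_nat_in_Nats zero_le_imp_eq_int)
  qed
  then show "\<exists>D>0. \<forall>s. (if s = r \<and> r \<ge> 0 then c else 0) \<noteq> 0 \<longrightarrow> s * of_nat D \<in> \<nat>"
    using r by (intro exI[of _ "nat b"]) auto
qed

lemma pcoeff_pmonom [simp]: "r \<ge> 0 \<Longrightarrow> pcoeff (pmonom c r) s = (if s = r then c else 0)"
  by transfer auto

lemma pmonom_0 [simp]: "pmonom 0 r = 0"
  by transfer auto

lemma pmonom_1: "pmonom 1 0 = 1"
  by (rule puiseux_eqI) (simp add: pcoeff_1)

lemma pmonom_minus: "r \<ge> 0 \<Longrightarrow> pmonom (- c) r = - pmonom c r"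
  by (rule puiseux_eqI) simp

lemma pmonom_sum: "r \<ge> 0 \<Longrightarrow> pmonom (\<Sum>i\<in>A. c i) r = (\<Sum>i\<in>A. pmonom (c i) r)"
  by (rule puiseux_eqI) simp

lemma starts_with_pmonom: "r \<ge> 0 \<Longrightarrow> starts_with (pmonom c r) c r"
  by (simp add: starts_with_def)

lemma pmonom_mult:
  assumes "r \<ge> 0" "s \<ge> 0"
  shows "pmonom c r * pmonom d s = pmonom (c * d) (r + s)"
proof (rule puiseux_eqI)
  fix t
  have "pcoeff (pmonom c r * pmonom d s) t =
      (\<Sum>u | u = r \<and> t = r + s \<and> c \<noteq> 0 \<and> d \<noteq> 0. c * d)"
    unfolding times_puiseux.rep_eq using assms
    by (intro sum.cong) (auto split: if_splits)
  also have "\<dots> = (if t = r + s then c * d else 0)"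
    by (cases "t = r + s \<and> c \<noteq> 0 \<and> d \<noteq> 0") auto
  finally show "pcoeff (pmonom c r * pmonom d s) t = pcoeff (pmonom (c * d) (r + s)) t"
    using assms by simp
qed

text \<open>After ramification a finite sum is a polynomial, whose radius of convergence is
  infinite, so membership depends on the exponents alone.\<close>

lemma finite_support_CPuiseux_ram:
  assumes "D > 0" "psupp D a" "finite {r. pcoeff a r \<noteq> 0}"
  shows "a \<in> CPuiseux_ram D"
proof -
  obtain g where g: "a = ramify D g" using assms psupp_imp_ramify by blast
  have "fps_nth g n \<noteq> 0 \<Longrightarrow> n \<in> (\<lambda>r. nat \<lfloor>r * of_nat D\<rfloor>) ` {r. pcoeff a r \<noteq> 0}" for n
    using assms(1) g by (intro image_eqI[of _ _ "of_nat n / of_nat D"]) auto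
  then have "finite {n. fps_nth g n \<noteq> 0}"
    by (intro finite_subset[OF _ finite_imageI[OF assms(3)]]) blast
  then obtain m where m: "\<And>n. n \<in> {n. fps_nth g n \<noteq> 0} \<Longrightarrow> n < m"
    by (meson finite_nat_bounded lessThan_iff subsetD)
  have "g = fps_of_poly (Poly (map (fps_nth g) [0..<m]))"
    using m by (intro fps_ext) (force simp: nth_default_def)
  then have "fps_conv_radius g = \<infinity>" by (metis fps_conv_radius_fps_of_poly)
  then show ?thesis using g by (auto simp: CPuiseux_ram_def)
qed

lemma finite_support_CPuiseux: "finite {r. pcoeff a r \<noteq> 0} \<Longrightarrow> a \<in> CPuiseux"
  using finite_support_CPuiseux_ram by (metis CPuiseux_def UN_I greaterThan_iff psupp_exists)

text \<open>These are the test series for a ball: \<open>is_FB\<close> speaks about convergent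
  series only, and every c has to be realised by one of them.\<close>

lemma CPuiseux_truncation_add_pmonom:
  assumes "h \<ge> 0"
  shows "prestrict {..<h} a + pmonom c h \<in> CPuiseux"
proof (rule finite_support_CPuiseux)
  show "finite {r. pcoeff (prestrict {..<h} a + pmonom c h) r \<noteq> 0}"
    by (rule finite_subset[of _ "insert h {r. pcoeff a r \<noteq> 0 \<and> r \<le> h}"])
       (use assms finite_pcoeff_le in auto)
qed

section \<open>Conjugation by roots of unity\<close>

lemma pcoeff_pconj: "pcoeff (pconj D \<theta> a) r = pcoeff a r * \<theta> ^ nat \<lfloor>r * of_nat D\<rfloor>"
  by transfer auto

lemma pcoeff_pconj_eq_0_iff [simp]: "\<theta> \<noteq> 0 \<Longrightarrow> pcoeff (pconj D \<theta> a) r = 0 \<longleftrightarrow> pcoeff a r = 0"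
  by (simp add: pcoeff_pconj)

lemma pconj_0 [simp]: "pconj D \<theta> 0 = 0"
  by (rule puiseux_eqI) (simp add: pcoeff_pconj)

lemma pconj_add: "pconj D \<theta> (a + b) = pconj D \<theta> a + pconj D \<theta> b"
  by (rule puiseux_eqI) (simp add: pcoeff_pconj algebra_simps)

lemma pconj_1 [simp]: "pconj D \<theta> 1 = 1"
  by (rule puiseux_eqI) (simp add: pcoeff_pconj pcoeff_1)

lemma pconj_prestrict: "pconj D \<theta> (prestrict S a) = prestrict S (pconj D \<theta> a)"
  by (rule puiseux_eqI) (simp add: pcoeff_pconj)

lemma pconj_pconj: "pconj D \<theta> (pconj D \<eta> a) = pconj D (\<theta> * \<eta>) a"
  by (rule puiseux_eqI) (simp add: pcoeff_pconj power_mult_distrib mult_ac)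

lemma pconj_one [simp]: "pconj D 1 a = a"
  by (rule puiseux_eqI) (simp add: pcoeff_pconj)

lemma pconj_pmonom: "h \<ge> 0 \<Longrightarrow> pconj D \<theta> (pmonom c h) = pmonom (\<theta> ^ nat \<lfloor>h * of_nat D\<rfloor> * c) h"
  by (rule puiseux_eqI) (simp add: pcoeff_pconj)

text \<open>On exponents in (1/D)N the floor in \<open>pconj\<close> is exact, hence additive, and
  the weight \<theta>^(rD) is multiplicative. For other exponents the floors need not add
  up.\<close>

lemma pconj_mult:
  assumes "psupp D a" "psupp D b" "\<theta> \<noteq> 0"
  shows "pconj D \<theta> (a * b) = pconj D \<theta> a * pconj D \<theta> b"
proof (rule puiseux_eqI)
  fix r
  have "pcoeff a s * pcoeff b (r - s) * \<theta> ^ nat \<lfloor>r * of_nat D\<rfloor> =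
      pcoeff (pconj D \<theta> a) s * pcoeff (pconj D \<theta> b) (r - s)"
    if "pcoeff a s \<noteq> 0" "pcoeff b (r - s) \<noteq> 0" for s
  proof -
    have "s * of_nat D \<in> \<nat>" "(r - s) * of_nat D \<in> \<nat>"
      using that assms(1,2) by (auto simp: psupp_def)
    then obtain m n where m: "s * of_nat D = of_nat m" and n: "(r - s) * of_nat D = of_nat n"
      by (elim Nats_cases)
    have "r * of_nat D = of_nat (m + n)" using m n by (simp add: algebra_simps)
    then show ?thesis by (simp only: pcoeff_pconj m n floor_of_nat nat_int power_add) (simp add: mult_ac)
  qed
  then show "pcoeff (pconj D \<theta> (a * b)) r = pcoeff (pconj D \<theta> a * pconj D \<theta> b) r"
    using assms(3) unfolding times_puiseux.rep_eq pcoeff_pconj[of D \<theta> "a * b"] sum_distrib_right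
    by (intro sum.cong) auto
qed

lemma pconj_power:
  "D > 0 \<Longrightarrow> psupp D a \<Longrightarrow> \<theta> \<noteq> 0 \<Longrightarrow> pconj D \<theta> (a ^ n) = pconj D \<theta> a ^ n"
  by (induction n) (simp_all add: pconj_mult psupp_power)

lemma pconj_of_fps:
  assumes "\<theta> ^ D = 1"
  shows "pconj D \<theta> (of_fps g) = of_fps g"
proof (rule puiseux_eqI)
  fix r :: rat
  have "\<theta> ^ nat \<lfloor>r * of_nat D\<rfloor> = 1" if "r \<in> \<nat>"
  proof -
    from that obtain n where "r = of_nat n" by (auto elim: Nats_cases)
    then have "nat \<lfloor>r * of_nat D\<rfloor> = D * n" by (metis floor_of_nat mult.commute nat_int of_nat_mult)
    then show ?thesis using assms by (simp add: power_mult)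
  qed
  moreover have "pcoeff (of_fps g) r = 0" if "r \<notin> \<nat>"
    using that pcoeff_ramify_0[of r 1 g] by (simp add: of_fps_def)
  ultimately show "pcoeff (pconj D \<theta> (of_fps g)) r = pcoeff (of_fps g) r"
    by (cases "r \<in> \<nat>") (simp_all add: pcoeff_pconj)
qed

text \<open>The coefficients of f as a series in y contain only integral powers of x, which a D-th
  root of unity fixes. Conjugation therefore passes to the argument.\<close>

lemma pconj_psubst:
  assumes "D > 0" "psupp D a" "\<theta> ^ D = 1"
  shows "psubst f (pconj D \<theta> a) = pconj D \<theta> (psubst f a)"
proof (rule puiseux_eqI)
  fix r
  have \<theta>: "\<theta> \<noteq> 0" using assms by (metis power_0_left zero_neq_one less_irrefl)
  have "of_fps (fps_nth f j) * pconj D \<theta> a ^ j = pconj D \<theta> (of_fps (fps_nth f j) * a ^ j)" for j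
    using assms \<theta> by (simp add: pconj_mult pconj_power psupp_of_fps psupp_power pconj_of_fps)
  then show "pcoeff (psubst f (pconj D \<theta> a)) r = pcoeff (pconj D \<theta> (psubst f a)) r"
    using \<theta> by (simp add: pcoeff_psubst pcoeff_pconj sum_distrib_right)
qed

lemma starts_with_pconj:
  "starts_with a c q \<Longrightarrow> starts_with (pconj D \<theta> a) (\<theta> ^ nat \<lfloor>q * of_nat D\<rfloor> * c) q"
  by (simp add: starts_with_def pcoeff_pconj)

section \<open>Evaluation at a series of positive order\<close>

text \<open>Convergence of the partial sums, eventually exact on all exponents up to r at once. It
  is a relation because the coefficients of G may have unbounded denominators, and then the sum need
  not be a Puiseux series.\<close>

definition evals :: "puiseux fps \<Rightarrow> puiseux \<Rightarrow> puiseux \<Rightarrow> bool" where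
  "evals G a s \<longleftrightarrow> (\<forall>r. \<exists>J0. \<forall>J\<ge>J0. \<forall>t\<le>r.
     pcoeff (\<Sum>j\<le>J. fps_nth G j * a ^ j) t = pcoeff s t)"

lemma evalsI:
  assumes "\<And>r. \<exists>J0. \<forall>J\<ge>J0. \<forall>t\<le>r. pcoeff (\<Sum>j\<le>J. fps_nth G j * a ^ j) t = pcoeff s t"
  shows "evals G a s"
  using assms by (simp add: evals_def)

lemma evalsD:
  assumes "evals G a s"
  obtains J0 where "\<And>J t. J \<ge> J0 \<Longrightarrow> t \<le> r \<Longrightarrow> pcoeff (\<Sum>j\<le>J. fps_nth G j * a ^ j) t = pcoeff s t"
  using assms unfolding evals_def by meson

text \<open>All exponents of \<open>a\<close> are at least 1/D, so a^j has order at least j/D and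
  exceeds r as soon as j > r D. Multiplying by c does not lower the order, so the bound is uniform
  in c.\<close>

lemma pcoeff_power_high:
  assumes "pcoeff a 0 = 0"
  obtains J0 where "\<And>j c t. j \<ge> J0 \<Longrightarrow> t \<le> r \<Longrightarrow> pcoeff (c * a ^ j) t = 0"
proof -
  obtain D where D: "D > 0" "psupp D a" by (rule psupp_exists)
  have "pcoeff a s = 0" if "s < 1 / of_nat D" for s
  proof (rule ccontr)
    assume nz: "pcoeff a s \<noteq> 0"
    then have "s * of_nat D \<in> \<nat>" using D by (simp add: psupp_def)
    then obtain n where n: "s = of_nat n / of_nat D" using D rat_Nats_cases by blast
    with that D have "n = 0" by (simp add: divide_less_cancel)
    with n nz assms show False by simp
  qed
  then have a: "starts_with a (pcoeff a (1 / of_nat D)) (1 / of_nat D)"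
    by (simp add: starts_with_def)
  have "pcoeff (c * a ^ j) t = 0" if j: "j \<ge> nat \<lceil>r * of_nat D\<rceil> + 1" and t: "t \<le> r" for c j t
  proof -
    have "starts_with (\<Prod>i\<in>{..<j}. a) (\<Prod>i\<in>{..<j}. pcoeff a (1 / of_nat D)) (\<Sum>i\<in>{..<j}. 1 / of_nat D)"
      using a by (intro starts_with_prod)
    then have "starts_with (a ^ j) (pcoeff a (1 / of_nat D) ^ j) (of_nat j / of_nat D)" by simp
    from starts_with_mult_0[OF this, of c]
    have *: "\<And>t. t < of_nat j / of_nat D \<Longrightarrow> pcoeff (c * a ^ j) t = 0"
      by (simp add: starts_with_def)
    have "r * of_nat D \<le> of_int \<lceil>r * of_nat D\<rceil>" by simp
    also have "\<dots> < of_nat j" using j by linarith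
    finally have "r < of_nat j / of_nat D" using D by (simp add: field_simps)
    with t * show ?thesis by (meson le_less_trans)
  qed
  then show ?thesis using that by blast
qed

lemma evals_unique: "evals G a s \<Longrightarrow> evals G a s' \<Longrightarrow> s = s'"
proof (rule puiseux_eqI)
  fix r assume e: "evals G a s" "evals G a s'"
  obtain J where J: "\<And>K t. K \<ge> J \<Longrightarrow> t \<le> r \<Longrightarrow> pcoeff (\<Sum>j\<le>K. fps_nth G j * a ^ j) t = pcoeff s t"
    using evalsD[OF e(1), of r] by blast
  obtain J' where J': "\<And>K t. K \<ge> J' \<Longrightarrow> t \<le> r \<Longrightarrow> pcoeff (\<Sum>j\<le>K. fps_nth G j * a ^ j) t = pcoeff s' t"
    using evalsD[OF e(2), of r] by blast
  show "pcoeff s r = pcoeff s' r"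
    using J[of "max J J'" r] J'[of "max J J'" r] by simp
qed

lemma evals_psubst:
  assumes "pcoeff a 0 = 0"
  shows "evals (lift_y f) a (psubst f a)"
proof (rule evalsI)
  fix r
  obtain J0 where J0: "\<And>j c t. j \<ge> J0 \<Longrightarrow> t \<le> r \<Longrightarrow> pcoeff (c * a ^ j) t = 0"
    using pcoeff_power_high[OF assms] by blast
  have "pcoeff (\<Sum>j\<le>J. fps_nth (lift_y f) j * a ^ j) t = pcoeff (psubst f a) t"
    if J: "J \<ge> J0" and t: "t \<le> r" for J t
  proof -
    have "{j. pcoeff (of_fps (fps_nth f j) * a ^ j) t \<noteq> 0} \<subseteq> {..J}"
    proof clarify
      fix j assume nz: "pcoeff (of_fps (fps_nth f j) * a ^ j) t \<noteq> 0"
      then have "\<not> j \<ge> J0" using J0 t by blast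
      then show "j \<le> J" using J by simp
    qed
    then have "pcoeff (psubst f a) t = (\<Sum>j\<le>J. pcoeff (of_fps (fps_nth f j) * a ^ j) t)"
      unfolding pcoeff_psubst by (intro sum.mono_neutral_left) auto
    then show ?thesis by (simp add: lift_y_def)
  qed
  then show "\<exists>J0. \<forall>J\<ge>J0. \<forall>t\<le>r. pcoeff (\<Sum>j\<le>J. fps_nth (lift_y f) j * a ^ j) t = pcoeff (psubst f a) t"
    by blast
qed

lemma evals_0: "evals 0 a 0"
  by (simp add: evals_def)

lemma evals_add:
  assumes "evals G a s" "evals H a u"
  shows "evals (G + H) a (s + u)"
proof (rule evalsI)
  fix r
  obtain J where J: "\<And>K t. K \<ge> J \<Longrightarrow> t \<le> r \<Longrightarrow> pcoeff (\<Sum>j\<le>K. fps_nth G j * a ^ j) t = pcoeff s t"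
    using evalsD[OF assms(1), of r] by blast
  obtain J' where J': "\<And>K t. K \<ge> J' \<Longrightarrow> t \<le> r \<Longrightarrow> pcoeff (\<Sum>j\<le>K. fps_nth H j * a ^ j) t = pcoeff u t"
    using evalsD[OF assms(2), of r] by blast
  show "\<exists>J0. \<forall>J\<ge>J0. \<forall>t\<le>r. pcoeff (\<Sum>j\<le>J. fps_nth (G + H) j * a ^ j) t = pcoeff (s + u) t"
    by (rule exI[of _ "max J J'"])
       (auto simp: distrib_right sum.distrib J[symmetric] J'[symmetric] simp del: pcoeff_sum)
qed

lemma evals_sum: "(\<And>k. k \<in> A \<Longrightarrow> evals (G k) a (s k)) \<Longrightarrow> evals (\<Sum>k\<in>A. G k) a (\<Sum>k\<in>A. s k)"
  by (induction A rule: infinite_finite_induct) (auto simp: evals_0 evals_add)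

lemma pcoeff_mult_vanish:
  assumes "\<And>t. t \<le> r \<Longrightarrow> pcoeff u t = 0" "t \<le> r"
  shows "pcoeff (u * v) t = 0"
proof -
  have "pcoeff u s = 0 \<or> pcoeff v (t - s) = 0" for s
    using assms(1)[of s] assms(2) pcoeff_neg[of "t - s" v] by (cases "s \<le> r") auto
  then show ?thesis unfolding times_puiseux.rep_eq by (intro sum.neutral) auto
qed

text \<open>The partial sums telescope up to the single term \<open>fps_nth G K * a ^ Suc K\<close>,
  whose order passes every bound as K grows.\<close>

lemma evals_mult_linear:
  assumes "pcoeff a 0 = 0" "evals G a s"
  shows "evals (G * (fps_X - fps_const \<alpha>)) a (s * (a - \<alpha>))"
proof (rule evalsI)
  fix r
  obtain J where J: "\<And>K t. K \<ge> J \<Longrightarrow> t \<le> r \<Longrightarrow> pcoeff (\<Sum>j\<le>K. fps_nth G j * a ^ j) t = pcoeff s t"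
    using evalsD[OF assms(2), of r] by blast
  obtain J' where J': "\<And>j c t. j \<ge> J' \<Longrightarrow> t \<le> r \<Longrightarrow> pcoeff (c * a ^ j) t = 0"
    using pcoeff_power_high[OF assms(1)] by blast
  have tele: "(\<Sum>j\<le>K. fps_nth (G * (fps_X - fps_const \<alpha>)) j * a ^ j) =
      (\<Sum>j\<le>K. fps_nth G j * a ^ j) * (a - \<alpha>) - fps_nth G K * a ^ Suc K" for K
    by (induction K) (simp_all add: algebra_simps)
  have "pcoeff (\<Sum>j\<le>K. fps_nth (G * (fps_X - fps_const \<alpha>)) j * a ^ j) t = pcoeff (s * (a - \<alpha>)) t"
    if "K \<ge> max J J'" "t \<le> r" for K t
  proof -
    have "pcoeff (((\<Sum>j\<le>K. fps_nth G j * a ^ j) - s) * (a - \<alpha>)) t = 0"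
      by (rule pcoeff_mult_vanish[of r]) (use J that in auto)
    moreover have "pcoeff (fps_nth G K * a ^ Suc K) t = 0"
      using that by (intro J') auto
    ultimately show ?thesis unfolding tele by (simp add: left_diff_distrib del: power_Suc)
  qed
  then show "\<exists>J0. \<forall>J\<ge>J0. \<forall>t\<le>r.
      pcoeff (\<Sum>j\<le>J. fps_nth (G * (fps_X - fps_const \<alpha>)) j * a ^ j) t = pcoeff (s * (a - \<alpha>)) t"
    by blast
qed

lemma evals_mult_prod:
  assumes "pcoeff a 0 = 0" "evals G a s"
  shows "evals (G * (\<Prod>i\<in>A. fps_X - fps_const (\<alpha> i))) a (s * (\<Prod>i\<in>A. a - \<alpha> i))"
proof (induction A rule: infinite_finite_induct)
  case (insert x A)
  from evals_mult_linear[OF assms(1) this(3), of "\<alpha> x"] insert(1,2)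
  show ?case by (simp add: mult_ac)
qed (use assms in auto)

lemma psubst_factored:
  assumes "pcoeff a 0 = 0" "lift_y g = lift_y u * (\<Prod>i\<in>A. fps_X - fps_const (\<beta> i))"
  shows "psubst g a = psubst u a * (\<Prod>i\<in>A. a - \<beta> i)"
  using evals_psubst[OF assms(1), of g] evals_mult_prod[OF assms(1) evals_psubst[OF assms(1), of u]]
  unfolding assms(2) by (rule evals_unique)

lemma fps_deriv_prod_linear:
  fixes \<beta> :: "'a \<Rightarrow> puiseux"
  assumes "finite A"
  shows "fps_deriv (\<Prod>i\<in>A. fps_X - fps_const (\<beta> i)) =
    (\<Sum>k\<in>A. \<Prod>i\<in>A - {k}. fps_X - fps_const (\<beta> i))"
  using assms
proof (induction A)
  case (insert x A)
  let ?X = "\<lambda>i. fps_X - fps_const (\<beta> i)"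
  have "(\<Sum>k\<in>A. \<Prod>i\<in>insert x A - {k}. ?X i) = ?X x * (\<Sum>k\<in>A. \<Prod>i\<in>A - {k}. ?X i)"
    unfolding sum_distrib_left
  proof (rule sum.cong[OF refl])
    fix k assume "k \<in> A"
    then have "insert x A - {k} = insert x (A - {k})" using insert by auto
    then show "(\<Prod>i\<in>insert x A - {k}. ?X i) = ?X x * (\<Prod>i\<in>A - {k}. ?X i)"
      using insert by simp
  qed
  moreover have "(\<Prod>i\<in>insert x A - {x}. ?X i) = (\<Prod>i\<in>A. ?X i)" using insert by simp
  ultimately show ?case using insert by (simp add: algebra_simps)
qed auto

lemma of_nat_mult_of_fps: "of_nat n * of_fps g = of_fps (of_nat n * g)"
  by (induction n) (simp_all add: of_fps_def ramify_0 ramify_add distrib_right)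

lemma lift_y_fps_deriv: "lift_y (fps_deriv f) = fps_deriv (lift_y f)"
  by (rule fps_ext) (simp add: lift_y_def of_nat_mult_of_fps del: of_nat_Suc)

text \<open>The summand with the derivative of the unit stands apart because on a ball its order is
  too high to reach the initial term.\<close>

lemma psubst_fps_deriv_factored:
  assumes "pcoeff a 0 = 0" "lift_y g = lift_y u * (\<Prod>i\<in>A. fps_X - fps_const (\<beta> i))" "finite A"
  shows "psubst (fps_deriv g) a = psubst (fps_deriv u) a * (\<Prod>i\<in>A. a - \<beta> i) +
    psubst u a * (\<Sum>k\<in>A. \<Prod>i\<in>A - {k}. a - \<beta> i)"
proof (rule evals_unique)
  show "evals (lift_y (fps_deriv g)) a (psubst (fps_deriv g) a)"
    using assms(1) by (rule evals_psubst)
  have "lift_y (fps_deriv g) = lift_y (fps_deriv u) * (\<Prod>i\<in>A. fps_X - fps_const (\<beta> i)) +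
      (\<Sum>k\<in>A. lift_y u * (\<Prod>i\<in>A - {k}. fps_X - fps_const (\<beta> i)))"
    using assms(3)
    by (simp add: lift_y_fps_deriv assms(2) fps_deriv_prod_linear sum_distrib_left)
  moreover have "evals \<dots> a (psubst (fps_deriv u) a * (\<Prod>i\<in>A. a - \<beta> i) +
      (\<Sum>k\<in>A. psubst u a * (\<Prod>i\<in>A - {k}. a - \<beta> i)))"
    using assms(1) by (intro evals_add evals_sum evals_mult_prod evals_psubst)
  ultimately show "evals (lift_y (fps_deriv g)) a (psubst (fps_deriv u) a * (\<Prod>i\<in>A. a - \<beta> i) +
      psubst u a * (\<Sum>k\<in>A. \<Prod>i\<in>A - {k}. a - \<beta> i))"
    by (simp add: sum_distrib_left)
qed

lemma pcoeff_mult_0: "pcoeff (a * b) 0 = pcoeff a 0 * pcoeff b 0"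
  using starts_with_mult[OF starts_with_const_coeff[of a] starts_with_const_coeff[of b]]
  by (simp add: starts_with_def)

lemma pcoeff_of_fps_0: "pcoeff (of_fps g) 0 = fps_nth g 0"
  using pcoeff_ramify_of_nat[of 1 g 0] by (simp add: of_fps_def)

lemma pcoeff_power_0: "pcoeff (a ^ j) 0 = pcoeff a 0 ^ j"
  by (induction j) (simp_all add: pcoeff_mult_0 pcoeff_1)

lemma pcoeff_psubst_0:
  assumes "pcoeff a 0 = 0"
  shows "pcoeff (psubst u a) 0 = fps_nth (fps_nth u 0) 0"
proof -
  have "pcoeff (of_fps (fps_nth u j) * a ^ j) 0 = (if j = 0 then fps_nth (fps_nth u 0) 0 else 0)" for j
    using assms by (simp add: pcoeff_mult_0 pcoeff_of_fps_0 pcoeff_power_0 zero_power)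
  then show ?thesis by (simp add: pcoeff_psubst)
qed

lemma psupp_psubst:
  assumes "D > 0" "psupp D a"
  shows "psupp D (psubst f a)"
  unfolding psupp_def
proof (intro allI impI)
  fix r assume "pcoeff (psubst f a) r \<noteq> 0"
  then obtain j where "pcoeff (of_fps (fps_nth f j) * a ^ j) r \<noteq> 0"
    unfolding pcoeff_psubst by (metis (mono_tags, lifting) mem_Collect_eq sum.neutral)
  then show "r * of_nat D \<in> \<nat>"
    using psupp_mult[OF assms(1) psupp_of_fps[OF assms(1)] psupp_power[OF assms]]
    by (auto simp: psupp_def)
qed

lemma unit_C2_const: "unit_C2 u \<Longrightarrow> fps_nth (fps_nth u 0) 0 \<noteq> 0"
proof
  assume "unit_C2 u" and 0: "fps_nth (fps_nth u 0) 0 = 0"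
  then obtain h where "u * h = 1" by (auto simp: unit_C2_def)
  then have "fps_nth (fps_nth (u * h) 0) 0 = 1" by simp
  then show False using 0 by simp
qed

section \<open>Initial terms on a pseudo-ball\<close>

lemma mem_pball: "b \<in> pball a h \<longleftrightarrow> b \<in> CPuiseux \<and> (\<forall>r<h. pcoeff b r = pcoeff a r)"
  by (auto simp: pball_def contact_def porder_ge_iff)

lemma mem_pball_truncation:
  "h \<ge> 0 \<Longrightarrow> prestrict {..<h} a + pmonom c h \<in> pball a h"
  by (auto simp: mem_pball CPuiseux_truncation_add_pmonom)

text \<open>The truncated centre plus \<open>c x^h\<close> stays in the first ball for every c. If h
  < k, all members of the second ball share one coefficient at h, which c = 0 and c = 1
  contradict.\<close>

lemma pball_height_le:
  assumes "h \<ge> 0" "pball a h \<subseteq> pball b k"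
  shows "k \<le> h"
proof (rule ccontr)
  assume "\<not> k \<le> h"
  have "pcoeff (prestrict {..<h} a + pmonom c h) h = pcoeff b h" for c
  proof -
    have "prestrict {..<h} a + pmonom c h \<in> pball b k"
      using assms(2) mem_pball_truncation[OF assms(1), of a c] by blast
    with \<open>\<not> k \<le> h\<close> show ?thesis by (metis mem_pball not_le)
  qed
  from this[of 0] this[of 1] show False using assms(1) by simp
qed

lemma height_pball:
  assumes "a \<in> CPuiseux" "h > 0"
  shows "height (pball a h) = h"
  unfolding height_def
proof (rule the_equality)
  fix k assume "k > 0 \<and> (\<exists>b\<in>CPuiseux. pball a h = pball b k)"
  then show "k = h" using assms pball_height_le[of h a] pball_height_le[of k _ a h]
    by (metis order.antisym order_refl less_imp_le)
qed (use assms in auto)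

lemma lambda_pball:
  assumes "a \<in> CPuiseux" "h > 0"
  shows "lambda (pball a h) = prestrict {..<h} a"
proof -
  have eq: "prestrict {..<h} a = prestrict {..<h} b" if "b \<in> pball a h" for b
    by (rule puiseux_eqI) (use that in \<open>auto simp: mem_pball\<close>)
  have "a \<in> pball a h" using assms by (simp add: mem_pball)
  then show ?thesis
    unfolding lambda_def height_pball[OF assms] using eq by (intro the_equality) blast+
qed

lemma pball_eq_iff:
  assumes "a \<in> CPuiseux" "b \<in> CPuiseux"
  shows "pball a h = pball b h \<longleftrightarrow> (\<forall>r<h. pcoeff a r = pcoeff b r)"
proof
  assume "pball a h = pball b h"
  moreover have "a \<in> pball a h" using assms by (simp add: mem_pball)
  ultimately have "a \<in> pball b h" by simp
  then show "\<forall>r<h. pcoeff a r = pcoeff b r" by (simp add: mem_pball)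
qed (auto simp: mem_pball)

lemma prestrict_eq_iff:
  "prestrict {..<h} a = prestrict {..<h} b \<longleftrightarrow> (\<forall>r<h. pcoeff a r = pcoeff b r)"
  by (metis lessThan_iff pcoeff_prestrict puiseux_eqI)

text \<open>
  For $b = l + c x^h + \cdots$ with $l$ truncated below $h$, the difference $b - \beta$
  starts with \<open>poly (local_poly l h \<beta>) c\<close> at exponent \<open>local_exp l h \<beta>\<close>.
\<close>

definition agrees_below :: "puiseux \<Rightarrow> rat \<Rightarrow> puiseux \<Rightarrow> bool" where
  "agrees_below l h \<beta> \<longleftrightarrow> (\<forall>r<h. pcoeff \<beta> r = pcoeff l r)"

definition local_exp :: "puiseux \<Rightarrow> rat \<Rightarrow> puiseux \<Rightarrow> rat" where
  "local_exp l h \<beta> = (if agrees_below l h \<beta> then h else (LEAST r. pcoeff (l - \<beta>) r \<noteq> 0))"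

definition local_poly :: "puiseux \<Rightarrow> rat \<Rightarrow> puiseux \<Rightarrow> complex poly" where
  "local_poly l h \<beta> = (if agrees_below l h \<beta> then [:- pcoeff \<beta> h, 1:]
     else [:pcoeff (l - \<beta>) (local_exp l h \<beta>):])"

lemma local_exp_far:
  assumes "\<not> agrees_below l h \<beta>"
  shows "local_exp l h \<beta> < h" "pcoeff (l - \<beta>) (local_exp l h \<beta>) \<noteq> 0"
    "\<And>r. r < local_exp l h \<beta> \<Longrightarrow> pcoeff (l - \<beta>) r = 0"
proof -
  obtain s where s: "s < h" "pcoeff (l - \<beta>) s \<noteq> 0"
    using assms by (auto simp: agrees_below_def)
  then have "l - \<beta> \<noteq> 0" by (metis pcoeff_0)
  then obtain q where q: "pcoeff (l - \<beta>) q \<noteq> 0" "\<And>r. r < q \<Longrightarrow> pcoeff (l - \<beta>) r = 0"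
    using pcoeff_least by blast
  have "(LEAST r. pcoeff (l - \<beta>) r \<noteq> 0) = q"
    by (rule Least_equality) (use q in \<open>meson not_less\<close>)+
  then have [simp]: "local_exp l h \<beta> = q" using assms by (simp add: local_exp_def)
  have "q \<le> s" using q(2)[of s] s(2) by (meson not_less)
  then show "local_exp l h \<beta> < h" using s by simp
  show "pcoeff (l - \<beta>) (local_exp l h \<beta>) \<noteq> 0"
    "\<And>r. r < local_exp l h \<beta> \<Longrightarrow> pcoeff (l - \<beta>) r = 0" using q by simp_all
qed

lemma local_poly_nonzero: "local_poly l h \<beta> \<noteq> 0"
  using local_exp_far by (auto simp: local_poly_def)

lemma poly_local_poly_eq_0_iff:
  "poly (local_poly l h \<beta>) c = 0 \<longleftrightarrow> agrees_below l h \<beta> \<and> pcoeff \<beta> h = c"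
  using local_exp_far(2)[of l h \<beta>] by (auto simp: local_poly_def)

text \<open>If \<beta> agrees with l below h, then b and \<beta> can differ at h at the earliest,
  where c enters the coefficient. Otherwise \<beta> separates from l before h, and the term c x^h
  comes too late to matter.\<close>

lemma starts_with_local:
  assumes "\<And>r. r \<ge> h \<Longrightarrow> pcoeff l r = 0" "starts_with (b - l) c h"
  shows "starts_with (b - \<beta>) (poly (local_poly l h \<beta>) c) (local_exp l h \<beta>)"
proof (cases "agrees_below l h \<beta>")
  case True
  have "starts_with (l - \<beta>) (- pcoeff \<beta> h) h"
    using True assms(1) by (auto simp: starts_with_def agrees_below_def)
  from starts_with_add[OF assms(2) this] show ?thesis
    using True by (simp add: local_poly_def local_exp_def)
next
  case False
  note far = local_exp_far[OF False]
  have "starts_with (l - \<beta>) (pcoeff (l - \<beta>) (local_exp l h \<beta>)) (local_exp l h \<beta>)"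
    using far(3) by (simp add: starts_with_def)
  from starts_with_add[OF starts_with_less[OF assms(2) far(1)] this] show ?thesis
    using False by (simp add: local_poly_def)
qed

lemma starts_with_psubst_factored:
  assumes "lift_y g = lift_y u * (\<Prod>i\<in>A. fps_X - fps_const (\<beta> i))"
    and "\<And>r. r \<ge> h \<Longrightarrow> pcoeff l r = 0" "starts_with (b - l) c h" "pcoeff b 0 = 0"
  shows "starts_with (psubst g b)
    (poly (smult (fps_nth (fps_nth u 0) 0) (\<Prod>i\<in>A. local_poly l h (\<beta> i))) c)
    (\<Sum>i\<in>A. local_exp l h (\<beta> i))"
proof -
  have "starts_with (\<Prod>i\<in>A. b - \<beta> i) (\<Prod>i\<in>A. poly (local_poly l h (\<beta> i)) c)
      (\<Sum>i\<in>A. local_exp l h (\<beta> i))"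
    using starts_with_local[OF assms(2,3)] by (rule starts_with_prod)
  from starts_with_mult_0[OF this, of "psubst u b"] show ?thesis
    by (simp add: psubst_factored[OF assms(4,1)] pcoeff_psubst_0 assms(4) poly_prod)
qed

text \<open>Each summand of the product rule loses one factor, and a factor has exponent at most h;
  this is the drop by h. The summands losing exactly h assemble to the derivative of the polynomial
  of g.\<close>

lemma starts_with_psubst_fps_deriv:
  assumes "lift_y g = lift_y u * (\<Prod>i\<in>A. fps_X - fps_const (\<beta> i))" "finite A" "h > 0"
    and "\<And>r. r \<ge> h \<Longrightarrow> pcoeff l r = 0" "starts_with (b - l) c h" "pcoeff b 0 = 0"
  shows "starts_with (psubst (fps_deriv g) b)
    (poly (pderiv (smult (fps_nth (fps_nth u 0) 0) (\<Prod>i\<in>A. local_poly l h (\<beta> i)))) c)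
    ((\<Sum>i\<in>A. local_exp l h (\<beta> i)) - h)"
proof -
  let ?P = "\<lambda>i. local_poly l h (\<beta> i)" and ?q = "\<lambda>i. local_exp l h (\<beta> i)"
  let ?Q = "(\<Sum>i\<in>A. ?q i) - h" and ?u = "fps_nth (fps_nth u 0) 0"
  have loc: "starts_with (b - \<beta> i) (poly (?P i) c) (?q i)" for i
    using assms(4,5) by (rule starts_with_local)
  have "starts_with (\<Prod>i\<in>A. b - \<beta> i) (\<Prod>i\<in>A. poly (?P i) c) (\<Sum>i\<in>A. ?q i)"
    using loc by (rule starts_with_prod)
  \<comment> \<open>The full product lives at exponent \<open>?Q + h\<close>, so at
    \<open>?Q\<close> the summand with the derivative of the unit contributes 0.\<close>
  then have "starts_with (\<Prod>i\<in>A. b - \<beta> i) 0 ?Q"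
    using assms(3) by (elim starts_with_less) simp
  from starts_with_mult_0[OF this, of "psubst (fps_deriv u) b"]
  have 1: "starts_with (psubst (fps_deriv u) b * (\<Prod>i\<in>A. b - \<beta> i)) 0 ?Q" by simp
  have "starts_with (\<Prod>i\<in>A - {k}. b - \<beta> i)
      ((\<Prod>i\<in>A - {k}. poly (?P i) c) * poly (pderiv (?P k)) c) ?Q" if "k \<in> A" for k
  proof -
    have sw: "starts_with (\<Prod>i\<in>A - {k}. b - \<beta> i) (\<Prod>i\<in>A - {k}. poly (?P i) c) (\<Sum>i\<in>A - {k}. ?q i)"
      using loc by (rule starts_with_prod)
    have q: "(\<Sum>i\<in>A - {k}. ?q i) = (\<Sum>i\<in>A. ?q i) - ?q k"
      using that assms(2) by (simp add: sum_diff1)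
    \<comment> \<open>Deleting a root that agrees with l lowers the exponent by exactly h. Deleting
      any other lowers it by less, so that summand vanishes at \<open>?Q\<close>, in accordance with
      the zero derivative of a constant \<open>local_poly\<close>.\<close>
    show ?thesis
    proof (cases "agrees_below l h (\<beta> k)")
      case True
      with sw q show ?thesis by (simp add: local_poly_def local_exp_def pderiv_pCons)
    next
      case False
      then have "?Q < (\<Sum>i\<in>A - {k}. ?q i)" using q local_exp_far(1)[OF False] by simp
      from starts_with_less[OF sw this] False show ?thesis
        by (simp add: local_poly_def pderiv_pCons)
    qed
  qed
  from starts_with_mult_0[OF starts_with_sum[OF this], where a = "psubst u b"]
  have "starts_with (psubst u b * (\<Sum>k\<in>A. \<Prod>i\<in>A - {k}. b - \<beta> i))
      (?u * (\<Sum>k\<in>A. (\<Prod>i\<in>A - {k}. poly (?P i) c) * poly (pderiv (?P k)) c)) ?Q"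
    by (simp add: pcoeff_psubst_0 assms(6))
  from starts_with_add[OF 1 this] show ?thesis
    by (simp add: psubst_fps_deriv_factored[OF assms(6,1,2)] pderiv_smult pderiv_prod
        poly_sum poly_prod)
qed

lemma exists_not_root: "(F::complex poly) \<noteq> 0 \<Longrightarrow> \<exists>c. poly F c \<noteq> 0"
  using poly_all_0_iff_0 by blast

text \<open>A value c that is a root of neither polynomial fixes the exponent; the coefficients at
  all c then fix the polynomial.\<close>

lemma starts_with_poly_unique:
  fixes F G :: "complex poly"
  assumes "F \<noteq> 0" "G \<noteq> 0" "\<And>c. \<exists>s. starts_with s (poly F c) q \<and> starts_with s (poly G c) q'"
  shows "F = G \<and> q = q'"
proof -
  obtain c where "poly (F * G) c \<noteq> 0"
    using exists_not_root[of "F * G"] assms by auto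
  with assms(3)[of c] have q: "q = q'" by (auto dest: starts_with_unique)
  have "poly F c = poly G c" for c using assms(3)[of c] q by (auto dest!: starts_with_pcoeff)
  then show ?thesis using q by (simp add: poly_eq_poly_eq_iff[symmetric] fun_eq_iff)
qed

lemma is_FB_unique:
  assumes "a \<in> CPuiseux" "h > 0" "is_FB g (pball a h) F q" "is_FB g (pball a h) G q'"
  shows "F = G \<and> q = q'"
proof (rule starts_with_poly_unique)
  show "F \<noteq> 0" "G \<noteq> 0" using assms by (auto simp: is_FB_def)
  fix c
  let ?b = "prestrict {..<h} a + pmonom c h"
  have "?b \<in> CPuiseux" "starts_with (?b - prestrict {..<h} a) c h"
    using assms(2) by (auto simp: CPuiseux_truncation_add_pmonom starts_with_pmonom)
  then show "\<exists>s. starts_with s (poly F c) q \<and> starts_with s (poly G c) q'"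
    using assms(3,4) unfolding is_FB_def lambda_pball[OF assms(1,2)] height_pball[OF assms(1,2)]
    by blast
qed

lemma FB_qB_eqI:
  assumes "a \<in> CPuiseux" "h > 0" "is_FB g (pball a h) F q"
  shows "FB g (pball a h) = F" "qB g (pball a h) = q"
  unfolding FB_def qB_def using is_FB_unique[OF assms(1,2) assms(3)] assms(3) by blast+

lemma is_FB_pball_iff:
  assumes "a \<in> CPuiseux" "h > 0"
  shows "is_FB g (pball a h) F q \<longleftrightarrow> F \<noteq> 0 \<and> (\<forall>b\<in>CPuiseux. \<forall>c.
    starts_with (b - prestrict {..<h} a) c h \<longrightarrow> starts_with (psubst g b) (poly F c) q)"
  by (simp add: is_FB_def lambda_pball[OF assms] height_pball[OF assms])

lemma pcoeff_0_of_starts_with: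
  assumes "h > 0" "pcoeff a 0 = 0" "starts_with (b - prestrict {..<h} a) c h"
  shows "pcoeff b 0 = 0"
proof -
  have "pcoeff (b - prestrict {..<h} a) 0 = 0"
    using assms unfolding starts_with_def by blast
  then show ?thesis using assms by simp
qed

text \<open>The existence half of the characterisation: together with \<open>is_FB_unique\<close> it
  makes \<open>FB\<close> an explicit product and \<open>qB\<close> an explicit sum over the
  roots.\<close>

lemma is_FB_factored:
  assumes "lift_y g = lift_y u * (\<Prod>i\<in>A. fps_X - fps_const (\<beta> i))"
    and "unit_C2 u" "a \<in> frac_series" "h > 0" "finite A"
  shows "is_FB g (pball a h)
    (smult (fps_nth (fps_nth u 0) 0) (\<Prod>i\<in>A. local_poly (prestrict {..<h} a) h (\<beta> i)))
    (\<Sum>i\<in>A. local_exp (prestrict {..<h} a) h (\<beta> i))"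
  using assms(2-) starts_with_psubst_factored[OF assms(1), of h "prestrict {..<h} a"]
    pcoeff_0_of_starts_with[of h a]
  by (subst is_FB_pball_iff)
    (auto simp: frac_series_iff unit_C2_const local_poly_nonzero)

lemma is_FB_fps_deriv:
  assumes "lift_y g = lift_y u * (\<Prod>i\<in>A. fps_X - fps_const (\<beta> i))" "finite A"
    and "unit_C2 u" "a \<in> frac_series" "h > 0" "pderiv (FB g (pball a h)) \<noteq> 0"
  shows "is_FB (fps_deriv g) (pball a h) (pderiv (FB g (pball a h))) (qB g (pball a h) - h)"
proof -
  have a: "a \<in> CPuiseux" "pcoeff a 0 = 0" using assms by (auto simp: frac_series_iff)
  note FB = FB_qB_eqI[OF a(1) assms(5) is_FB_factored[OF assms(1,3,4,5,2)]]
  show ?thesis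
    unfolding is_FB_pball_iff[OF a(1) assms(5)]
    using starts_with_psubst_fps_deriv[OF assms(1,2,5), of "prestrict {..<h} a"] assms(5,6)
      pcoeff_0_of_starts_with[of h a] a(2)
    unfolding FB by auto
qed

text \<open>Roots that leave l before h contribute nonzero constants; k collects them.\<close>

lemma local_prod:
  assumes "finite A"
  shows "\<exists>k. k \<noteq> 0 \<and> (\<Prod>i\<in>A. local_poly l h (\<beta> i)) =
    smult k (\<Prod>i | i \<in> A \<and> agrees_below l h (\<beta> i). [:- pcoeff (\<beta> i) h, 1:])"
  using assms
proof (induction A)
  case empty
  then show ?case by (intro exI[of _ 1]) auto
next
  case (insert x A)
  then obtain k where k: "k \<noteq> 0" "(\<Prod>i\<in>A. local_poly l h (\<beta> i)) =
    smult k (\<Prod>i | i \<in> A \<and> agrees_below l h (\<beta> i). [:- pcoeff (\<beta> i) h, 1:])" by blast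
  show ?case
  proof (cases "agrees_below l h (\<beta> x)")
    case True
    then have "{i \<in> insert x A. agrees_below l h (\<beta> i)} = insert x {i \<in> A. agrees_below l h (\<beta> i)}"
      by auto
    moreover have "local_poly l h (\<beta> x) = [:- pcoeff (\<beta> x) h, 1:]"
      using True by (simp add: local_poly_def)
    ultimately show ?thesis using insert.hyps k by (intro exI[of _ k]) simp
  next
    case False
    then have "{i \<in> insert x A. agrees_below l h (\<beta> i)} = {i \<in> A. agrees_below l h (\<beta> i)}"
      by auto
    moreover have "local_poly l h (\<beta> x) = [:pcoeff (l - \<beta> x) (local_exp l h (\<beta> x)):]"
      using False by (simp add: local_poly_def)
    ultimately show ?thesis using insert.hyps k local_exp_far(2)[OF False]
      by (intro exI[of _ "pcoeff (l - \<beta> x) (local_exp l h (\<beta> x)) * k"])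
        (simp add: mult.commute)
  qed
qed

section \<open>The tree model and conjugation\<close>

locale factored_germ =
  fixes f e :: "complex fps fps" and \<alpha> :: "nat \<Rightarrow> puiseux" and p D :: nat
  assumes unit_e: "unit_C2 e"
    and frac_\<alpha>: "\<And>i. i \<in> {1..p} \<Longrightarrow> \<alpha> i \<in> frac_series"
    and factored: "lift_y f = lift_y e * (\<Prod>i=1..p. fps_X - fps_const (\<alpha> i))"
    and D_pos: "D > 0"
    and psupp_\<alpha>: "\<And>i. i \<in> {1..p} \<Longrightarrow> psupp D (\<alpha> i)"
begin

lemma psubst_eq_0_iff:
  assumes "pcoeff a 0 = 0"
  shows "psubst f a = 0 \<longleftrightarrow> a \<in> \<alpha> ` {1..p}"
proof -
  have "pcoeff (psubst e a) 0 \<noteq> 0"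
    using unit_C2_const[OF unit_e] by (simp add: pcoeff_psubst_0[OF assms])
  then have "psubst e a \<noteq> 0" by (metis pcoeff_0)
  then show ?thesis unfolding psubst_factored[OF assms factored] by auto
qed

lemma Zer_eq: "Zer f = \<alpha> ` {1..p}"
  using frac_\<alpha> psubst_eq_0_iff by (auto simp: Zer_def frac_series_iff)

lemma finite_Zer: "finite (Zer f)"
  by (simp add: Zer_eq)

lemma Zer_frac: "a \<in> Zer f \<Longrightarrow> a \<in> frac_series"
  and Zer_CPuiseux: "a \<in> Zer f \<Longrightarrow> a \<in> CPuiseux"
  and Zer_pcoeff_0: "a \<in> Zer f \<Longrightarrow> pcoeff a 0 = 0"
  by (auto simp: Zer_def frac_series_iff)

lemma Zer_psupp: "a \<in> Zer f \<Longrightarrow> psupp D a"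
  using psupp_\<alpha> by (auto simp: Zer_eq)

lemma root_of_unity_nonzero: "\<theta> ^ D = 1 \<Longrightarrow> \<theta> \<noteq> (0::complex)"
  using D_pos by (metis power_0_left zero_neq_one less_irrefl)

lemma pconj_Zer:
  assumes "\<theta> ^ D = 1" "a \<in> Zer f"
  shows "pconj D \<theta> a \<in> Zer f"
proof -
  have "psubst f (pconj D \<theta> a) = 0"
    using assms Zer_psupp[OF assms(2)] D_pos by (simp add: pconj_psubst Zer_def)
  moreover have "pcoeff (pconj D \<theta> a) 0 = 0"
    using Zer_pcoeff_0[OF assms(2)] by (simp add: pcoeff_pconj)
  ultimately show ?thesis using psubst_eq_0_iff by (simp add: Zer_eq)
qed

text \<open>The coefficient form of O(a, a') = h for some root a'. It lets the balls of the tree be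
  handled through a centre and a height.\<close>

definition branching :: "puiseux \<Rightarrow> rat \<Rightarrow> bool" where
  "branching a h \<longleftrightarrow> a \<in> Zer f \<and>
     (\<exists>a'\<in>Zer f. pcoeff a h \<noteq> pcoeff a' h \<and> (\<forall>r<h. pcoeff a r = pcoeff a' r))"

lemma Tree_iff: "B \<in> Tree f \<longleftrightarrow> (\<exists>a h. branching a h \<and> B = pball a h)"
  unfolding Tree_def branching_def contact_def porder_eq_iff by fastforce

lemma branching_Zer: "branching a h \<Longrightarrow> a \<in> Zer f"
  by (simp add: branching_def)

lemma branching_pos: "branching a h \<Longrightarrow> h > 0"
  unfolding branching_def using Zer_pcoeff_0 pcoeff_neg by (metis linorder_neqE)

text \<open>Of two roots separated at h, at least one has a nonzero coefficient there.\<close>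

lemma branching_psupp: "branching a h \<Longrightarrow> h * of_nat D \<in> \<nat>"
  unfolding branching_def using Zer_psupp by (metis psupp_def)

lemma branching_pconj:
  assumes "\<theta> ^ D = 1" "branching a h"
  shows "branching (pconj D \<theta> a) h"
proof -
  obtain a' where a': "a \<in> Zer f" "a' \<in> Zer f" "pcoeff a h \<noteq> pcoeff a' h"
    "\<forall>r<h. pcoeff a r = pcoeff a' r" using assms(2) by (auto simp: branching_def)
  then show ?thesis using pconj_Zer[OF assms(1)] root_of_unity_nonzero[OF assms(1)]
    unfolding branching_def by (intro conjI bexI[of _ "pconj D \<theta> a'"]) (auto simp: pcoeff_pconj)
qed

lemma branching_CPuiseux: "branching a h \<Longrightarrow> a \<in> CPuiseux"
  using branching_Zer Zer_CPuiseux by blast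

lemma is_FB_FB:
  assumes "branching a h"
  shows "is_FB f (pball a h) (FB f (pball a h)) (qB f (pball a h))"
  using is_FB_factored[OF factored unit_e Zer_frac[OF branching_Zer[OF assms]] branching_pos[OF assms]]
    FB_qB_eqI[OF branching_CPuiseux[OF assms] branching_pos[OF assms]] by force

lemma FB_nonzero: "branching a h \<Longrightarrow> FB f (pball a h) \<noteq> 0"
  using is_FB_FB by (auto simp: is_FB_def)

lemma starts_with_FB:
  assumes "branching a h" "b \<in> CPuiseux" "starts_with (b - prestrict {..<h} a) c h"
  shows "starts_with (psubst f b) (poly (FB f (pball a h)) c) (qB f (pball a h))"
  using assms is_FB_FB[OF assms(1)]
  by (simp add: is_FB_pball_iff branching_CPuiseux branching_pos)

lemma starts_with_FB_pball:
  assumes "branching a h" "b \<in> pball a h"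
  shows "starts_with (psubst f b) (poly (FB f (pball a h)) (pcoeff b h)) (qB f (pball a h))"
  using assms by (intro starts_with_FB) (auto simp: mem_pball starts_with_def)

text \<open>In the product formula for \<open>FB\<close>, roots of f outside the ball give nonzero
  constants, and a root b inside gives the factor z - \<open>pcoeff b h\<close>.\<close>

lemma poly_FB_eq_0_iff:
  assumes "branching a h"
  shows "poly (FB f (pball a h)) c = 0 \<longleftrightarrow> (\<exists>b\<in>Zer f. b \<in> pball a h \<and> pcoeff b h = c)"
proof -
  have "FB f (pball a h) = smult (fps_nth (fps_nth e 0) 0)
      (\<Prod>i=1..p. local_poly (prestrict {..<h} a) h (\<alpha> i))"
    using is_FB_factored[OF factored unit_e Zer_frac[OF branching_Zer[OF assms]] branching_pos[OF assms]]
      FB_qB_eqI(1)[OF branching_CPuiseux[OF assms] branching_pos[OF assms]] by force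
  then have "poly (FB f (pball a h)) c = 0 \<longleftrightarrow>
      (\<exists>b\<in>Zer f. poly (local_poly (prestrict {..<h} a) h b) c = 0)"
    using unit_C2_const[OF unit_e] by (auto simp: poly_prod Zer_eq)
  also have "\<dots> \<longleftrightarrow> (\<exists>b\<in>Zer f. agrees_below (prestrict {..<h} a) h b \<and> pcoeff b h = c)"
    by (simp add: poly_local_poly_eq_0_iff)
  also have "\<dots> \<longleftrightarrow> (\<exists>b\<in>Zer f. b \<in> pball a h \<and> pcoeff b h = c)"
    using Zer_CPuiseux by (auto simp: agrees_below_def mem_pball)
  finally show ?thesis .
qed

text \<open>They come from the two roots of f that separate at h. This makes \<open>FB\<close>
  nonconstant and later forces a critical point that is not a root.\<close>

lemma FB_two_roots:
  assumes "branching a h"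
  obtains c d where "c \<noteq> d" "poly (FB f (pball a h)) c = 0" "poly (FB f (pball a h)) d = 0"
proof -
  obtain a' where "a \<in> Zer f" "a' \<in> Zer f" "pcoeff a h \<noteq> pcoeff a' h"
    "\<forall>r<h. pcoeff a r = pcoeff a' r" using assms by (auto simp: branching_def)
  then show ?thesis
    using that[of "pcoeff a h" "pcoeff a' h"] Zer_CPuiseux poly_FB_eq_0_iff[OF assms]
    by (metis mem_pball)
qed

lemma pderiv_FB_nonzero:
  assumes "branching a h"
  shows "pderiv (FB f (pball a h)) \<noteq> 0"
proof
  assume "pderiv (FB f (pball a h)) = 0"
  then obtain c where "FB f (pball a h) = [:c:]"
    by (metis degree_eq_zeroE pderiv_eq_0_iff)
  with FB_two_roots[OF assms] FB_nonzero[OF assms] show False by auto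
qed

text \<open>A member of the ball has contact at least h with the centre, so the maximum is h iff no
  root of f has higher contact. Higher contact means lying in the ball and sharing the coefficient
  at h, which makes that coefficient a root of \<open>FB\<close>.\<close>

lemma leaves_at_iff:
  assumes "branching a h" "b \<in> CPuiseux"
  shows "leaves_at f b (pball a h) \<longleftrightarrow> b \<in> pball a h \<and> poly (FB f (pball a h)) (pcoeff b h) \<noteq> 0"
proof -
  have h: "height (pball a h) = h"
    by (simp add: height_pball branching_CPuiseux[OF assms(1)] branching_pos[OF assms(1)])
  have ne: "a \<in> Zer f" using branching_Zer[OF assms(1)] .
  have "ereal (real_of_rat h) = Max ((\<lambda>a. contact a b) ` Zer f) \<longleftrightarrow>
      poly (FB f (pball a h)) (pcoeff b h) \<noteq> 0" if b: "b \<in> pball a h"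
  proof -
    have high: "contact c b > ereal (real_of_rat h) \<longleftrightarrow> c \<in> pball a h \<and> pcoeff c h = pcoeff b h"
      if "c \<in> Zer f" for c
      using that b Zer_CPuiseux by (auto simp: contact_def porder_gt_iff mem_pball order_le_less)
    have ge: "contact a b \<ge> ereal (real_of_rat h)"
      using b by (simp add: contact_def porder_ge_iff mem_pball)
    have "Max ((\<lambda>a. contact a b) ` Zer f) = ereal (real_of_rat h) \<longleftrightarrow>
        (\<forall>c\<in>Zer f. \<not> contact c b > ereal (real_of_rat h))"
    proof
      assume "Max ((\<lambda>a. contact a b) ` Zer f) = ereal (real_of_rat h)"
      then show "\<forall>c\<in>Zer f. \<not> contact c b > ereal (real_of_rat h)"
        using finite_Zer by (metis Max_ge finite_imageI imageI not_le)
    next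
      assume *: "\<forall>c\<in>Zer f. \<not> contact c b > ereal (real_of_rat h)"
      then have "contact a b = ereal (real_of_rat h)" using ge ne by force
      then show "Max ((\<lambda>a. contact a b) ` Zer f) = ereal (real_of_rat h)"
        using * ne finite_Zer by (intro Max_eqI) (auto simp: not_less intro: rev_image_eqI)
    qed
    then show ?thesis using high by (auto simp: poly_FB_eq_0_iff[OF assms(1)])
  qed
  then show ?thesis using assms(1) by (auto simp: leaves_at_def Tree_iff h)
qed

text \<open>Evaluate f at a test series with exponents in (1/D)N and with c not a root of
  \<open>FB\<close>: the value again has exponents in (1/D)N, and its order is exactly
  \<open>qB\<close>.\<close>

lemma qB_psupp:
  assumes "branching a h"
  shows "qB f (pball a h) * of_nat D \<in> \<nat>"
proof -
  obtain c where c: "poly (FB f (pball a h)) c \<noteq> 0"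
    using exists_not_root[OF FB_nonzero[OF assms]] by blast
  let ?b = "prestrict {..<h} a + pmonom c h"
  have h: "h > 0" by (rule branching_pos[OF assms])
  have "psupp D (pmonom c h)"
    using branching_psupp[OF assms] h by (auto simp: psupp_def split: if_splits)
  then have "psupp D ?b"
    using Zer_psupp[OF branching_Zer[OF assms]] by (intro psupp_add psupp_prestrict)
  then have "psupp D (psubst f ?b)" using D_pos by (intro psupp_psubst)
  moreover have "starts_with (psubst f ?b) (poly (FB f (pball a h)) c) (qB f (pball a h))"
    using assms h by (intro starts_with_FB) (auto simp: CPuiseux_truncation_add_pmonom starts_with_pmonom)
  ultimately show ?thesis using c by (auto simp: psupp_def starts_with_def)
qed

text \<open>The initial term of f at a conjugated test series is computed twice: by conjugating the
  value of f, which multiplies F_B(c) by \<theta>^(qD), and from the conjugate ball, where the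
  coefficient at h is \<theta>^(hD) c.\<close>

lemma FB_pconj:
  assumes "branching a h" "\<theta> ^ D = 1"
  shows "qB f (pball (pconj D \<theta> a) h) = qB f (pball a h)"
    and "poly (FB f (pball (pconj D \<theta> a) h)) (\<theta> ^ nat \<lfloor>h * of_nat D\<rfloor> * c) =
      \<theta> ^ nat \<lfloor>qB f (pball a h) * of_nat D\<rfloor> * poly (FB f (pball a h)) c"
proof -
  let ?a = "pconj D \<theta> a"
  let ?F = "FB f (pball a h)" and ?G = "FB f (pball ?a h)"
  let ?q = "qB f (pball a h)" and ?r = "qB f (pball ?a h)"
  let ?\<kappa> = "\<theta> ^ nat \<lfloor>h * of_nat D\<rfloor>" and ?\<mu> = "\<theta> ^ nat \<lfloor>?q * of_nat D\<rfloor>"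
  note br = branching_pconj[OF assms(2,1)]
  have \<theta>: "\<theta> \<noteq> 0" using assms(2) by (rule root_of_unity_nonzero)
  have h: "h > 0" by (rule branching_pos[OF assms(1)])
  have "pcompose ?G [:0, ?\<kappa>:] = smult ?\<mu> ?F \<and> ?r = ?q"
  proof (rule starts_with_poly_unique)
    show "smult ?\<mu> ?F \<noteq> 0" using FB_nonzero[OF assms(1)] \<theta> by simp
    show "pcompose ?G [:0, ?\<kappa>:] \<noteq> 0" using FB_nonzero[OF br] \<theta> by (simp add: pcompose_eq_0_iff)
    fix c
    let ?b = "prestrict {..<h} a + pmonom c h"
    have b: "pconj D \<theta> ?b = prestrict {..<h} ?a + pmonom (?\<kappa> * c) h"
      using h by (simp add: pconj_add pconj_prestrict pconj_pmonom)
    have "psupp D (pmonom c h)"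
      using branching_psupp[OF assms(1)] h by (auto simp: psupp_def split: if_splits)
    then have "psupp D ?b"
      using Zer_psupp[OF branching_Zer[OF assms(1)]] by (intro psupp_add psupp_prestrict)
    then have conj: "psubst f (pconj D \<theta> ?b) = pconj D \<theta> (psubst f ?b)"
      using D_pos assms(2) by (intro pconj_psubst)
    have "starts_with (psubst f ?b) (poly ?F c) ?q"
      using assms(1) h by (intro starts_with_FB) (auto simp: CPuiseux_truncation_add_pmonom starts_with_pmonom)
    then have "starts_with (psubst f (pconj D \<theta> ?b)) (?\<mu> * poly ?F c) ?q"
      unfolding conj by (rule starts_with_pconj)
    moreover have "starts_with (psubst f (pconj D \<theta> ?b)) (poly ?G (?\<kappa> * c)) ?r"
      unfolding b using br h
      by (intro starts_with_FB) (auto simp: CPuiseux_truncation_add_pmonom starts_with_pmonom)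
    ultimately show "\<exists>s. starts_with s (poly (pcompose ?G [:0, ?\<kappa>:]) c) ?r \<and>
        starts_with s (poly (smult ?\<mu> ?F) c) ?q"
      by (auto simp: poly_pcompose mult.commute)
  qed
  then have "?r = ?q" and "poly (pcompose ?G [:0, ?\<kappa>:]) c = poly (smult ?\<mu> ?F) c" by auto
  then show "?r = ?q" and "poly ?G (?\<kappa> * c) = ?\<mu> * poly ?F c"
    by (simp_all add: poly_pcompose mult.commute)
qed

text \<open>The derivative of \<open>FB\<close> and the product over the given roots both describe
  the initial terms of the y-derivative of f on the ball, so \<open>is_FB_unique\<close> identifies
  them.\<close>

lemma pderiv_FB_factored:
  assumes "branching a h" "unit_C2 e'" "finite A"
    and "\<And>j. j \<in> A \<Longrightarrow> \<gamma> j \<in> frac_series"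
    and "lift_y (fps_deriv f) = lift_y e' * (\<Prod>j\<in>A. fps_X - fps_const (\<gamma> j))"
  obtains k where "k \<noteq> 0" "pderiv (FB f (pball a h)) =
    smult k (\<Prod>j | j \<in> A \<and> \<gamma> j \<in> pball a h. [:- pcoeff (\<gamma> j) h, 1:])"
proof -
  let ?l = "prestrict {..<h} a" and ?u = "fps_nth (fps_nth e' 0) 0"
  note a = Zer_frac[OF branching_Zer[OF assms(1)]] and h = branching_pos[OF assms(1)]
  have "is_FB (fps_deriv f) (pball a h) (pderiv (FB f (pball a h))) (qB f (pball a h) - h)"
    using factored a h unit_e pderiv_FB_nonzero[OF assms(1)]
    by (intro is_FB_fps_deriv[where A = "{1..p}"]) auto
  moreover have "is_FB (fps_deriv f) (pball a h) (smult ?u (\<Prod>j\<in>A. local_poly ?l h (\<gamma> j)))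
      (\<Sum>j\<in>A. local_exp ?l h (\<gamma> j))"
    using assms(2,3,5) a h by (intro is_FB_factored)
  ultimately have *: "pderiv (FB f (pball a h)) = smult ?u (\<Prod>j\<in>A. local_poly ?l h (\<gamma> j))"
    using is_FB_unique[OF branching_CPuiseux[OF assms(1)] h] by blast
  obtain k where "k \<noteq> 0" "(\<Prod>j\<in>A. local_poly ?l h (\<gamma> j)) =
      smult k (\<Prod>j | j \<in> A \<and> agrees_below ?l h (\<gamma> j). [:- pcoeff (\<gamma> j) h, 1:])"
    using local_prod[OF assms(3), of ?l h \<gamma>] by blast
  moreover have "{j. j \<in> A \<and> agrees_below ?l h (\<gamma> j)} = {j. j \<in> A \<and> \<gamma> j \<in> pball a h}"
    using assms(4) by (auto simp: agrees_below_def mem_pball frac_series_iff)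
  ultimately show ?thesis
    using that[of "?u * k"] unit_C2_const[OF assms(2)] by (simp add: *)
qed

end

section \<open>Newton diagrams of products of linear factors\<close>

text \<open>With m = \<open>degree A\<close> this is u^(q m) A(v / u^q), where v has weight q and u
  has weight 1. It carries products of one-variable polynomials over to quasihomogeneous
  ones.\<close>

definition homogenize :: "rat \<Rightarrow> complex poly \<Rightarrow> puiseux poly" where
  "homogenize q A = (\<Sum>j\<le>degree A. monom (pmonom (coeff A j) (of_nat (degree A - j) * q)) j)"

lemma coeff_homogenize: "coeff (homogenize q A) j = pmonom (coeff A j) (of_nat (degree A - j) * q)"
  by (simp add: homogenize_def coeff_sum if_distrib[of "\<lambda>x. coeff x _"] coeff_eq_0)

lemma homogenize_1 [simp]: "homogenize q 1 = 1"
  by (simp add: homogenize_def pmonom_1 one_pCons)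

lemma homogenize_mult:
  assumes "q \<ge> 0" "A \<noteq> 0" "B \<noteq> 0"
  shows "homogenize q (A * B) = homogenize q A * homogenize q B"
proof (rule poly_eqI)
  fix n
  have "coeff (homogenize q A * homogenize q B) n =
      (\<Sum>i\<le>n. pmonom (coeff A i * coeff B (n - i)) (of_nat (degree (A * B) - n) * q))"
    unfolding coeff_mult coeff_homogenize
  proof (rule sum.cong[OF refl])
    fix i assume i: "i \<in> {..n}"
    show "pmonom (coeff A i) (of_nat (degree A - i) * q) *
        pmonom (coeff B (n - i)) (of_nat (degree B - (n - i)) * q) =
      pmonom (coeff A i * coeff B (n - i)) (of_nat (degree (A * B) - n) * q)"
    \<comment> \<open>The truncated subtractions are exact in this range; outside it one of the two
      coefficients is zero.\<close>
    proof (cases "i \<le> degree A \<and> n - i \<le> degree B")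
      case True
      then have "degree (A * B) - n = (degree A - i) + (degree B - (n - i))"
        unfolding degree_mult_eq[OF assms(2,3)] using i by auto
      then have "of_nat (degree (A * B) - n) * q =
          of_nat (degree A - i) * q + of_nat (degree B - (n - i)) * q"
        by (simp only: of_nat_add distrib_right)
      then show ?thesis using assms(1) by (simp add: pmonom_mult)
    next
      case False
      then have "coeff A i = 0 \<or> coeff B (n - i) = 0" by (auto intro: coeff_eq_0)
      then show ?thesis by auto
    qed
  qed
  also have "\<dots> = coeff (homogenize q (A * B)) n"
    unfolding coeff_homogenize coeff_mult using assms(1) by (subst pmonom_sum) auto
  finally show "coeff (homogenize q (A * B)) n = coeff (homogenize q A * homogenize q B) n" ..
qed

lemma homogenize_power: "q \<ge> 0 \<Longrightarrow> A \<noteq> 0 \<Longrightarrow> homogenize q (A ^ n) = homogenize q A ^ n"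
  by (induction n) (simp_all add: homogenize_mult)

lemma homogenize_prod:
  assumes "q \<ge> 0" "\<And>i. i \<in> S \<Longrightarrow> A i \<noteq> 0"
  shows "homogenize q (\<Prod>i\<in>S. A i) = (\<Prod>i\<in>S. homogenize q (A i))"
  using assms(2)
proof (induction S rule: infinite_finite_induct)
  case (insert x S)
  then have "A x \<noteq> 0" "prod A S \<noteq> 0" by auto
  with insert show ?case using assms(1) by (simp add: homogenize_mult)
qed auto

lemma degree_monom_minus_const: "M > 0 \<Longrightarrow> degree (monom 1 M - [:w:] :: 'a::comm_ring_1 poly) = M"
  by (rule antisym[OF degree_le le_degree]) (auto simp: coeff_pCons split: nat.splits)

lemma homogenize_monom_minus_const:
  assumes "M > 0" "q \<ge> 0"
  shows "homogenize q (monom 1 M - [:w:]) = monom 1 M - [:pmonom w (of_nat M * q):]"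
proof (rule poly_eqI)
  fix j
  show "coeff (homogenize q (monom 1 M - [:w:])) j = coeff (monom 1 M - [:pmonom w (of_nat M * q):]) j"
    using assms unfolding coeff_homogenize degree_monom_minus_const[OF assms(1)]
    by (cases j) (auto simp: pmonom_minus pmonom_1 coeff_pCons split: nat.splits)
qed

lemma lead_coeff_homogenize:
  assumes "lead_coeff A = 1"
  shows "lead_coeff (homogenize q A) = 1"
proof -
  have top: "coeff (homogenize q A) (degree A) = 1"
    using assms by (simp add: coeff_homogenize pmonom_1)
  moreover have "degree (homogenize q A) \<le> degree A"
    by (rule degree_le) (simp add: coeff_homogenize coeff_eq_0)
  ultimately have "degree (homogenize q A) = degree A"
    by (metis le_antisym le_degree zero_neq_one)
  with top show ?thesis by simp
qed

text \<open>The coefficient of v^j is a signed sum of products of card K - j of the g. For j > card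
  K the exponent is negative and both coefficients are zero, which \<open>starts_with\<close>
  admits.\<close>

lemma starts_with_coeff_prod_linear:
  assumes "finite K" "\<And>k. k \<in> K \<Longrightarrow> starts_with (g k) (c k) q"
  shows "starts_with (coeff (\<Prod>k\<in>K. [:- g k, 1:]) j) (coeff (\<Prod>k\<in>K. [:- c k, 1:]) j)
    ((of_nat (card K) - of_nat j) * q)"
  using assms
proof (induction K arbitrary: j)
  case empty
  have "starts_with (of_bool (j = 0)) (of_bool (j = 0)) (- of_nat j * q)"
    using starts_with_one by (cases "j = 0") auto
  then show ?case by (simp only: prod.empty coeff_1 card.empty of_nat_0 diff_0)
next
  case (insert x K)
  let ?P = "\<Prod>k\<in>K. [:- g k, 1:]" and ?A = "\<Prod>k\<in>K. [:- c k, 1:]"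
  have "starts_with (- g x * coeff ?P j) (- c x * coeff ?A j) (q + (of_nat (card K) - of_nat j) * q)"
    using insert by (intro starts_with_mult starts_with_minus) auto
  then have 1: "starts_with (- g x * coeff ?P j) (- c x * coeff ?A j)
      ((of_nat (card (insert x K)) - of_nat j) * q)"
    using insert(1,2) by (simp add: algebra_simps)
  show ?case
  proof (cases j)
    case 0
    with 1 insert(1,2) show ?thesis by simp
  next
    case (Suc i)
    have "starts_with (coeff ?P i) (coeff ?A i) ((of_nat (card K) - of_nat i) * q)"
      using insert by simp
    then have "starts_with (coeff ?P i) (coeff ?A i) ((of_nat (card (insert x K)) - of_nat j) * q)"
      using insert(1,2) Suc by simp
    from starts_with_add[OF 1 this] insert(1,2) Suc show ?thesis by simp
  qed
qed

text \<open>The point p lies inside segments of T that start a little behind p and run arbitrarily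
  far along the ray. A face containing p contains their end points, so it is unbounded.\<close>

lemma compact_face_no_ray:
  fixes p v :: "'a::euclidean_space"
  assumes "E face_of T" "compact E" "p \<in> E" "v \<noteq> 0" "\<epsilon> > 0" "p - \<epsilon> *\<^sub>R v \<in> T"
    and "\<And>s. s \<ge> 0 \<Longrightarrow> p + s *\<^sub>R v \<in> T"
  shows False
proof -
  have "p + s *\<^sub>R v \<in> E" if "s > 0" for s
  proof -
    have "p = (1 - \<epsilon> / (\<epsilon> + s)) *\<^sub>R (p - \<epsilon> *\<^sub>R v) + (\<epsilon> / (\<epsilon> + s)) *\<^sub>R (p + s *\<^sub>R v)"
    proof -
      have "(1 - \<epsilon> / (\<epsilon> + s)) * \<epsilon> = (\<epsilon> / (\<epsilon> + s)) * s"
        using assms(5) that by (simp add: field_simps)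
      then show ?thesis by (simp add: algebra_simps) (metis scaleR_add_left)
    qed
    moreover have "p - \<epsilon> *\<^sub>R v \<noteq> p + s *\<^sub>R v"
    proof
      assume "p - \<epsilon> *\<^sub>R v = p + s *\<^sub>R v"
      then have "(\<epsilon> + s) *\<^sub>R v = 0" by (simp add: algebra_simps)
      with assms(4,5) that show False by simp
    qed
    moreover have "0 < \<epsilon> / (\<epsilon> + s)" "\<epsilon> / (\<epsilon> + s) < 1" using assms(5) that by auto
    ultimately have "p \<in> open_segment (p - \<epsilon> *\<^sub>R v) (p + s *\<^sub>R v)"
      unfolding in_segment by blast
    then show ?thesis using assms(1,3,6) assms(7)[of s] that by (meson face_ofD less_imp_le)
  qed
  moreover obtain b where b: "\<And>x. x \<in> E \<Longrightarrow> norm x \<le> b"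
    using compact_imp_bounded[OF assms(2)] by (auto simp: bounded_iff)
  ultimately have *: "norm (p + s *\<^sub>R v) \<le> b" if "s > 0" for s using that by blast
  have "b \<ge> 0" using b[OF assms(3)] norm_ge_zero order_trans by blast
  \<comment> \<open>Chosen so that s v has norm b + |p| + 1; by the triangle inequality p + s v then
    exceeds the bound b.\<close>
  define s where "s = (b + norm p + 1) / norm v"
  have "s > 0" using \<open>b \<ge> 0\<close> assms(4) by (simp add: s_def add_nonneg_pos)
  have "b + norm p + 1 = norm (s *\<^sub>R v)"
    using \<open>b \<ge> 0\<close> assms(4) by (simp add: s_def)
  also have "\<dots> \<le> norm (p + s *\<^sub>R v) + norm p"
    by (metis add.commute add_diff_cancel_left' norm_triangle_ineq4)
  finally show False using *[OF \<open>s > 0\<close>] by simp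
qed

definition weighted_quadrant :: "real \<Rightarrow> real \<Rightarrow> (real \<times> real) set" where
  "weighted_quadrant q m = {(x, y). x \<ge> 0 \<and> y \<ge> 0 \<and> x + q * y \<ge> q * m}"

text \<open>A point strictly above the line can be moved both ways in an axis direction along which
  the set is unbounded, so no compact face contains it. Conversely the line supports the set and
  cuts out the segment from (0, m) to (q m, 0).\<close>

lemma weighted_quadrant_compact_edges:
  assumes "q > 0" "m > 0"
  shows "\<Union>{E. E edge_of weighted_quadrant q m \<and> compact E} =
    {(x, y). x \<ge> 0 \<and> y \<ge> 0 \<and> x + q * y = q * m}" (is "?L = ?E")
proof
  let ?T = "weighted_quadrant q m"
  show "?L \<subseteq> ?E"
  proof clarify
    fix x y E assume E: "E edge_of ?T" "compact E" "(x, y) \<in> E"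
    then have face: "E face_of ?T" by (simp add: edge_of_def)
    then have T: "x \<ge> 0" "y \<ge> 0" "x + q * y \<ge> q * m"
      using face_of_imp_subset[OF face] E(3) by (auto simp: weighted_quadrant_def)
    have False if gt: "x + q * y > q * m"
    proof (cases "x > 0")
      case True
      show False
      \<comment> \<open>A move to the left by this amount keeps x nonnegative and the point on or
        above the line.\<close>
      proof (rule compact_face_no_ray[OF face E(2,3), of "(1, 0)" "min x (x + q * y - q * m)"])
        show "0 < min x (x + q * y - q * m)" using True gt by simp
      qed (use T in \<open>auto simp: weighted_quadrant_def zero_prod_def\<close>)
    next
      case False
      then have "y > m" using T gt assms by simp
      show False
      proof (rule compact_face_no_ray[OF face E(2,3), of "(0, 1)" "y - m"])
        fix s :: real assume "s \<ge> 0"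
        then have "q * s \<ge> 0" using assms by simp
        then show "(x, y) + s *\<^sub>R (0, 1) \<in> ?T"
          using T \<open>s \<ge> 0\<close> by (auto simp: weighted_quadrant_def algebra_simps)
      qed (use T \<open>y > m\<close> assms in \<open>auto simp: weighted_quadrant_def zero_prod_def\<close>)
    qed
    then show "x \<ge> 0 \<and> y \<ge> 0 \<and> x + q * y = q * m" using T by fastforce
  qed
next
  let ?T = "weighted_quadrant q m"
  have half: "?T = {z. (1, 0) \<bullet> z \<ge> 0} \<inter> {z. (0, 1) \<bullet> z \<ge> 0} \<inter> {z. (1, q) \<bullet> z \<ge> q * m}"
    by (auto simp: weighted_quadrant_def)
  have "convex ?T" unfolding half by (intro convex_Int convex_halfspace_ge)
  then have "?T \<inter> {z. (1, q) \<bullet> z = q * m} face_of ?T"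
    by (rule face_of_Int_supporting_hyperplane_ge) (auto simp: weighted_quadrant_def)
  also have "?T \<inter> {z. (1, q) \<bullet> z = q * m} = ?E"
    by (auto simp: weighted_quadrant_def)
  finally have face: "?E face_of ?T" .
  have seg: "?E = closed_segment (0, m) (q * m, 0)"
  proof
    show "?E \<subseteq> closed_segment (0, m) (q * m, 0)"
    proof clarify
      fix x y :: real assume xy: "0 \<le> x" "0 \<le> y" "x + q * y = q * m"
      have "q * y \<ge> 0" using xy assms by simp
      moreover have "x = q * (m - y)" using xy by (simp add: algebra_simps)
      moreover have "0 \<le> m - y" using xy assms calculation by (simp add: zero_le_mult_iff)
      moreover define u where "u = (m - y) / m"
      moreover have um: "u * m = m - y" using assms by (simp add: u_def)
      moreover have "u * (q * m) = q * (m - y)" by (simp only: mult.left_commute[of u] um)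
      moreover have "(1 - u) * m = y" using um by (simp add: algebra_simps)
      ultimately show "(x, y) \<in> closed_segment (0, m) (q * m, 0)"
        unfolding in_segment using xy assms by (intro exI[of _ u]) (auto simp: divide_le_eq_1)
    qed
    show "closed_segment (0, m) (q * m, 0) \<subseteq> ?E"
    proof clarify
      fix x y assume "(x, y) \<in> closed_segment (0, m) (q * m, 0)"
      then obtain u where "0 \<le> u" "u \<le> 1" and xy: "x = u * (q * m)" "y = (1 - u) * m"
        by (auto simp: in_segment)
      moreover have "x + q * y = q * m" unfolding xy by (simp add: algebra_simps)
      ultimately show "0 \<le> x \<and> 0 \<le> y \<and> x + q * y = q * m" using assms by simp
    qed
  qed
  have "aff_dim ?E = 1"
    unfolding seg segment_convex_hull aff_dim_convex_hull using assms by simp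
  with face have "?E edge_of ?T" by (simp add: edge_of_def)
  moreover have "compact ?E" unfolding seg by (rule compact_segment)
  ultimately show "?E \<subseteq> ?L" by blast
qed

text \<open>The end coefficients of A produce the two vertices, every other term of P lies on or
  above the line through them, and the terms on it are those of A. Positive degree matters: the
  diagram of the constant 1 is a quadrant without compact edges, so its
  \<open>newton_initial\<close> is 0.\<close>

lemma newton_initial_eq_homogenize:
  assumes "lead_coeff A = 1" "degree A > 0" "coeff A 0 \<noteq> 0" "q > 0"
    and "degree P = degree A"
    and "\<And>j. starts_with (coeff P j) (coeff A j) ((of_nat (degree A) - of_nat j) * q)"
  shows "newton_initial P = homogenize q A"
proof -
  let ?m = "degree A" and ?q = "real_of_rat q"
  have q: "?q > 0" using assms(4) by simp
  have supp: "(of_nat ?m - of_nat j) * q \<le> i" "j \<le> ?m" if "pcoeff (coeff P j) i \<noteq> 0" for i j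
  proof -
    show "(of_nat ?m - of_nat j) * q \<le> i"
      using assms(6)[of j] that by (auto simp: starts_with_def not_less[symmetric])
    show "j \<le> ?m" using that assms(5) by (metis le_degree pcoeff_0)
  qed
  let ?S = "{(real_of_rat i + s, real j + t) | i j s t. pcoeff (coeff P j) i \<noteq> 0 \<and> s \<ge> 0 \<and> t \<ge> 0}"
  have S: "(real_of_rat ((of_nat ?m - of_nat j) * q) + s, real j + t) \<in> ?S"
    if "coeff A j \<noteq> 0" "s \<ge> 0" "t \<ge> 0" for j s t
    using starts_with_pcoeff[OF assms(6)[of j]] that
    by (intro CollectI exI[of _ "(of_nat ?m - of_nat j) * q"] exI[of _ j] exI[of _ s] exI[of _ t]) simp
  have top: "(s, real ?m + t) \<in> ?S" if "s \<ge> 0" "t \<ge> 0" for s t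
    using S[of ?m s t] that assms(1) by simp
  have bottom: "(?q * real ?m + s, t) \<in> ?S" if "s \<ge> 0" "t \<ge> 0" for s t
    using S[of 0 s t] that assms(3) by (simp add: of_rat_mult mult.commute)
  have "newton_diagram P = weighted_quadrant ?q (real ?m)"
    unfolding newton_diagram_def
  proof
    have "convex (weighted_quadrant ?q (real ?m))"
    proof -
      have "weighted_quadrant ?q (real ?m) = {z. (1, 0) \<bullet> z \<ge> 0} \<inter> {z. (0, 1) \<bullet> z \<ge> 0} \<inter>
          {z. (1, ?q) \<bullet> z \<ge> ?q * real ?m}"
        by (auto simp: weighted_quadrant_def)
      then show ?thesis by (simp only: convex_Int convex_halfspace_ge)
    qed
    moreover have "?S \<subseteq> weighted_quadrant ?q (real ?m)"
    proof clarify
      fix i j and s t :: real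
      assume *: "pcoeff (coeff P j) i \<noteq> 0" "s \<ge> 0" "t \<ge> 0"
      then have "i \<ge> 0" using pcoeff_neg not_le by blast
      have "real_of_rat ((of_nat ?m - of_nat j) * q) \<le> real_of_rat i"
        using supp(1)[OF *(1)] by (simp only: of_rat_less_eq)
      then have "?q * real ?m \<le> real_of_rat i + ?q * real j"
        by (simp add: of_rat_mult of_rat_diff algebra_simps)
      moreover have "?q * t \<ge> 0" using q * by simp
      ultimately show "(real_of_rat i + s, real j + t) \<in> weighted_quadrant ?q (real ?m)"
        using * \<open>i \<ge> 0\<close> by (simp add: weighted_quadrant_def algebra_simps)
    qed
    ultimately show "convex hull ?S \<subseteq> weighted_quadrant ?q (real ?m)"
      by (intro hull_minimal)
    show "weighted_quadrant ?q (real ?m) \<subseteq> convex hull ?S"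
    proof clarify
      fix x y assume "(x, y) \<in> weighted_quadrant ?q (real ?m)"
      then have xy: "x \<ge> 0" "y \<ge> 0" "x + ?q * y \<ge> ?q * real ?m"
        by (auto simp: weighted_quadrant_def)
      show "(x, y) \<in> convex hull ?S"
      proof (cases "y \<ge> real ?m")
        case True
        then show ?thesis using top[of x "y - real ?m"] xy by (intro hull_inc) simp
      next
        case False
        define u where "u = (real ?m - y) / real ?m"
        \<comment> \<open>The horizontal excess of the point over the line; shifting both vertices
          right by s puts the point on the segment between them.\<close>
        define s where "s = x - ?q * (real ?m - y)"
        have u: "0 \<le> u" "u \<le> 1" using False xy assms(2) by (auto simp: u_def field_simps)
        have s: "s \<ge> 0" using xy by (simp add: s_def algebra_simps)
        have "(1 - u) *\<^sub>R (s, real ?m) + u *\<^sub>R (?q * real ?m + s, 0) \<in> convex hull ?S"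
          using top[of s 0] bottom[of s 0] u s
          by (intro convexD[OF convex_convex_hull] hull_inc) auto
        moreover have "u * real ?m = real ?m - y" using assms(2) by (simp add: u_def)
        then have "(1 - u) * real ?m = y" by (simp add: algebra_simps)
        moreover have "(1 - u) * s + u * (?q * real ?m + s) = s + ?q * (u * real ?m)"
          by (simp add: algebra_simps)
        then have "(1 - u) * s + u * (?q * real ?m + s) = x"
          unfolding \<open>u * real ?m = real ?m - y\<close> by (simp add: s_def)
        ultimately show ?thesis by simp
      qed
    qed
  qed
  then have edges: "compact_edge_points P = {(x, y). x \<ge> 0 \<and> y \<ge> 0 \<and> x + ?q * y = ?q * real ?m}"
    using weighted_quadrant_compact_edges[OF q, of "real ?m"] assms(2)
    by (simp add: compact_edge_points_def)
  have "prestrict {i. (real_of_rat i, real j) \<in> compact_edge_points P} (coeff P j) =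
      pmonom (coeff A j) (of_nat (?m - j) * q)" if "j \<le> ?m" for j
  proof (rule puiseux_eqI)
    fix i
    have "real_of_rat i + ?q * real j = ?q * real ?m \<longleftrightarrow>
        real_of_rat i = real_of_rat (of_nat (?m - j) * q)"
    proof -
      have "real_of_rat (of_nat (?m - j) * q) = (real ?m - real j) * ?q"
        using that by (simp add: of_rat_mult of_rat_diff of_nat_diff)
      then show ?thesis by (simp only:) (auto simp: algebra_simps)
    qed
    then have "real_of_rat i + ?q * real j = ?q * real ?m \<longleftrightarrow> i = of_nat (?m - j) * q" by simp
    moreover have "pcoeff (coeff P j) (of_nat (?m - j) * q) = coeff A j"
      using starts_with_pcoeff[OF assms(6)[of j]] that by (simp add: of_nat_diff)
    moreover have "of_nat (?m - j) * q \<ge> 0" using assms(4) by simp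
    ultimately show "pcoeff (prestrict {i. (real_of_rat i, real j) \<in> compact_edge_points P} (coeff P j)) i =
        pcoeff (pmonom (coeff A j) (of_nat (?m - j) * q)) i"
      unfolding edges by auto
  qed
  then show ?thesis
    unfolding newton_initial_def homogenize_def assms(5) by (intro sum.cong) auto
qed

lemma newton_initial_prod_linear:
  assumes "finite K" "K \<noteq> {}" "q > 0"
    and "\<And>k. k \<in> K \<Longrightarrow> starts_with (g k) (c k) q" "\<And>k. k \<in> K \<Longrightarrow> c k \<noteq> 0"
  shows "newton_initial (\<Prod>k\<in>K. [:- g k, 1:]) = homogenize q (\<Prod>k\<in>K. [:- c k, 1:])"
proof -
  have deg: "degree (\<Prod>k\<in>K. [:- d k, 1:]) = card K" for d :: "'a \<Rightarrow> 'b::idom"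
    by (simp add: degree_prod_eq_sum_degree)
  show ?thesis
  proof (rule newton_initial_eq_homogenize)
    show "lead_coeff (\<Prod>k\<in>K. [:- c k, 1:]) = 1" by (simp add: lead_coeff_prod)
    show "degree (\<Prod>k\<in>K. [:- c k, 1:]) > 0" using assms(1,2) by (simp add: deg card_gt_0_iff)
    show "coeff (\<Prod>k\<in>K. [:- c k, 1:]) 0 \<noteq> 0"
      using assms(1,5) by (simp add: poly_0_coeff_0[symmetric] poly_prod)
    show "starts_with (coeff (\<Prod>k\<in>K. [:- g k, 1:]) j) (coeff (\<Prod>k\<in>K. [:- c k, 1:]) j)
        ((of_nat (degree (\<Prod>k\<in>K. [:- c k, 1:])) - of_nat j) * q)" for j
      unfolding deg using assms(1,4) by (rule starts_with_coeff_prod_linear)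
  qed (use assms in \<open>auto simp: deg\<close>)
qed

section \<open>Roots of unity and complex polynomials\<close>

text \<open>A k-th power multiplies every root multiplicity by k, so A and B have the same roots
  with multiplicity, and a monic complex polynomial is the product over its roots.\<close>

lemma monic_power_eq:
  fixes A B :: "complex poly"
  assumes "lead_coeff A = 1" "lead_coeff B = 1" "A ^ k = B ^ k" "k > 0"
  shows "A = B"
proof -
  have "proots A = proots B"
    using arg_cong[OF assms(3), of proots] assms(4)
    by (simp add: proots_power) (metis gr_implies_not0 repeat_mset_cancel1)
  then show ?thesis
    using complex_poly_decompose_multiset[of A] complex_poly_decompose_multiset[of B] assms(1,2)
    by simp
qed

lemma prod_linear_roots:
  fixes c :: complex
  assumes "c \<noteq> 0" "M > 0"
  shows "(\<Prod>z | z ^ M = c. [:- z, 1:]) = monom 1 M - [:c:]"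
proof -
  let ?P = "monom 1 M - [:c:] :: complex poly"
  have root: "poly ?P z = 0 \<longleftrightarrow> z ^ M = c" for z by (simp add: poly_monom)
  have lead: "lead_coeff ?P = 1"
    using assms by (auto simp: degree_monom_minus_const coeff_pCons split: nat.splits)
  \<comment> \<open>The derivative M z^(M-1) can vanish only at 0, which is not a root because c is
    nonzero.\<close>
  have "rsquarefree ?P"
    unfolding rsquarefree_roots
  proof clarify
    fix z assume "poly ?P z = 0" and d: "poly (pderiv ?P) z = 0"
    then have "z \<noteq> 0" using assms root by (auto simp: zero_power)
    moreover have "pderiv ?P = monom (of_nat M) (M - 1)"
      by (simp add: pderiv_diff pderiv_monom pderiv_pCons)
    ultimately show False using d assms by (simp add: poly_monom)
  qed
  from complex_poly_decompose_rsquarefree[OF this] show ?thesis unfolding lead root by simp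
qed

definition unity_root :: "nat \<Rightarrow> complex" where
  "unity_root D = exp (2 * of_real pi * \<i> / of_nat D)"

lemma unity_root_power: "unity_root D ^ k = exp (2 * of_real pi * \<i> * of_nat k / of_nat D)"
  by (simp add: unity_root_def exp_of_nat_mult[symmetric] mult_ac)

lemma unity_root_power_eq_1_iff: "D > 0 \<Longrightarrow> unity_root D ^ k = 1 \<longleftrightarrow> D dvd k"
  unfolding unity_root_power by (rule complex_root_unity_eq_1) simp

lemma power_eq_imp_dvd:
  fixes \<eta> :: complex
  assumes "\<And>n. \<eta> ^ n = 1 \<longleftrightarrow> M dvd n" "\<eta> \<noteq> 0" "\<eta> ^ i = \<eta> ^ j" "i \<le> j"
  shows "M dvd j - i"
proof -
  have "\<eta> ^ j = \<eta> ^ i * \<eta> ^ (j - i)" using assms(4) by (simp flip: power_add)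
  then have "\<eta> ^ (j - i) = 1" using assms(2,3) by simp
  then show ?thesis using assms(1) by simp
qed

lemma power_inj_on:
  fixes \<eta> :: complex
  assumes "\<And>n. \<eta> ^ n = 1 \<longleftrightarrow> M dvd n" "\<eta> \<noteq> 0"
  shows "inj_on (\<lambda>k. \<eta> ^ k) {..<M}"
proof (rule linorder_inj_onI)
  fix i j assume "i < j" "i \<in> {..<M}" "j \<in> {..<M}"
  then show "\<eta> ^ i \<noteq> \<eta> ^ j"
    using power_eq_imp_dvd[OF assms, of i j] dvd_imp_le[of M "j - i"] by force
qed auto

lemma unity_root_nonzero: "unity_root D \<noteq> 0"
  by (simp add: unity_root_def)

lemma bij_betw_unity_root:
  assumes "D > 0"
  shows "bij_betw (\<lambda>k. unity_root D ^ k) {..<D} {z. z ^ D = 1}"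
  unfolding bij_betw_def
proof
  show inj: "inj_on (\<lambda>k. unity_root D ^ k) {..<D}"
    using unity_root_power_eq_1_iff[OF assms] unity_root_nonzero by (rule power_inj_on)
  show "(\<lambda>k. unity_root D ^ k) ` {..<D} = {z. z ^ D = 1}"
  proof (rule card_subset_eq)
    show "finite {z::complex. z ^ D = 1}" using assms by (intro finite_roots_unity) simp
    show "(\<lambda>k. unity_root D ^ k) ` {..<D} \<subseteq> {z. z ^ D = 1}"
      using unity_root_power_eq_1_iff[OF assms] by (auto simp flip: power_mult)
    show "card ((\<lambda>k. unity_root D ^ k) ` {..<D}) = card {z::complex. z ^ D = 1}"
      using inj assms by (simp add: card_image card_roots_unity_eq)
  qed
qed

lemma prod_periodic:
  fixes h :: "nat \<Rightarrow> 'a::comm_monoid_mult"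
  assumes "\<And>k. h (k + M) = h k"
  shows "(\<Prod>k<s * M. h k) = (\<Prod>k<M. h k) ^ s"
proof -
  have shift: "h (k + m * M) = h k" for k m
    by (induction m) (use assms in \<open>simp_all add: add.assoc[symmetric] add.commute[of M]\<close>)
  have "(\<Prod>k<s * M. h k) = (\<Prod>m<s. prod h {m * M..<m * M + M})"
    by (rule prod.nat_group[symmetric])
  also have "\<dots> = (\<Prod>m<s. \<Prod>k<M. h k)"
  proof (rule prod.cong[OF refl])
    fix m
    have "prod h {0 + m * M..<M + m * M} = (\<Prod>k\<in>{0..<M}. h (k + m * M))"
      by (rule prod.shift_bounds_nat_ivl)
    then show "prod h {m * M..<m * M + M} = (\<Prod>k<M. h k)"
      by (simp add: shift add.commute atLeast0LessThan)
  qed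
  finally show ?thesis by simp
qed

text \<open>Write \<theta> as a power of a primitive root of unity of order M s. Its (L s)-th power
  \<eta> has order exactly M, as L and M are coprime. So the values \<theta>^(L s) w run s times
  through the M solutions of z^M = w^M.\<close>

lemma prod_linear_unity_powers:
  fixes w :: complex
  assumes "M > 0" "s > 0" "coprime L M" "w \<noteq> 0"
  shows "(\<Prod>\<theta> | \<theta> ^ (M * s) = 1. [:- (\<theta> ^ (L * s) * w), 1:]) = (monom 1 M - [:w ^ M:]) ^ s"
proof -
  define \<eta> where "\<eta> = unity_root (M * s) ^ (L * s)"
  have D: "M * s > 0" using assms by simp
  have \<eta>0: "\<eta> \<noteq> 0" by (simp add: \<eta>_def unity_root_nonzero)
  have \<eta>: "\<eta> ^ n = 1 \<longleftrightarrow> M dvd n" for n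
  proof -
    have "\<eta> ^ n = 1 \<longleftrightarrow> M * s dvd (L * n) * s"
      unfolding \<eta>_def power_mult[symmetric] unity_root_power_eq_1_iff[OF D] by (simp add: mult_ac)
    also have "\<dots> \<longleftrightarrow> M dvd L * n" using assms(2) by simp
    also have "\<dots> \<longleftrightarrow> M dvd n" using assms(3) by (simp add: coprime_dvd_mult_right_iff coprime_commute)
    finally show ?thesis .
  qed
  let ?h = "\<lambda>k. [:- (\<eta> ^ k * w), 1:]"
  have "(\<Prod>\<theta> | \<theta> ^ (M * s) = 1. [:- (\<theta> ^ (L * s) * w), 1:]) = (\<Prod>k<s * M. ?h k)"
    unfolding prod.reindex_bij_betw[OF bij_betw_unity_root[OF D], symmetric]
    by (simp add: \<eta>_def power_mult[symmetric] mult_ac)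
  also have "\<dots> = (\<Prod>k<M. ?h k) ^ s"
    using \<eta>[of M] by (intro prod_periodic) (simp add: power_add)
  also have "(\<Prod>k<M. ?h k) = (\<Prod>z\<in>(\<lambda>k. \<eta> ^ k * w) ` {..<M}. [:- z, 1:])"
    using power_inj_on[OF \<eta> \<eta>0] assms(4) by (subst prod.reindex) (auto simp: inj_on_def)
  also have "(\<lambda>k. \<eta> ^ k * w) ` {..<M} = {z. z ^ M = w ^ M}"
  proof (rule card_subset_eq)
    show "finite {z. z ^ M = w ^ M}"
      by (rule card_ge_0_finite) (use assms in \<open>simp add: card_nth_roots\<close>)
    have "(\<eta> ^ k) ^ M = 1" for k using \<eta>[of "k * M"] by (simp add: power_mult)
    then show "(\<lambda>k. \<eta> ^ k * w) ` {..<M} \<subseteq> {z. z ^ M = w ^ M}"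
      by (auto simp: power_mult_distrib)
    have "inj_on (\<lambda>k. \<eta> ^ k * w) {..<M}"
      using power_inj_on[OF \<eta> \<eta>0] assms(4) by (auto simp: inj_on_def)
    then show "card ((\<lambda>k. \<eta> ^ k * w) ` {..<M}) = card {z. z ^ M = w ^ M}"
      using assms by (simp add: card_image card_nth_roots)
  qed
  finally show ?thesis using assms by (simp add: prod_linear_roots)
qed

text \<open>If every root of F' were a root of F, counting orders would give deg F = deg F' +
  (number of distinct roots of F), so F would have only one root.\<close>

lemma exists_critical_nonroot:
  fixes F :: "complex poly"
  assumes "F \<noteq> 0" "c \<noteq> d" "poly F c = 0" "poly F d = 0"
  obtains z where "poly (pderiv F) z = 0" "poly F z \<noteq> 0"
proof -
  let ?R = "{z. poly F z = 0}" and ?R' = "{z. poly (pderiv F) z = 0}"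
  have fin: "finite ?R" using assms(1) by (rule poly_roots_finite)
  have "card {c, d} \<le> card ?R" using fin assms by (intro card_mono) auto
  then have two: "card ?R \<ge> 2" using assms(2) by simp
  have deg: "degree G = (\<Sum>z\<in>{z. poly G z = 0}. order z G)" if "G \<noteq> 0" for G :: "complex poly"
    using size_proots_complex[of G] that by (simp add: size_multiset_overloaded_eq)
  have "degree F \<noteq> 0"
  proof
    assume "degree F = 0"
    then obtain k where "F = [:k:]" by (rule degree_eq_zeroE)
    with assms show False by simp
  qed
  then have ne': "pderiv F \<noteq> 0" by (simp add: pderiv_eq_0_iff)
  have "\<not> ?R' \<subseteq> ?R"
  proof
    assume sub: "?R' \<subseteq> ?R"
    have ord: "order z F = Suc (order z (pderiv F))" if "z \<in> ?R" for z
      using order_pderiv[OF assms(1)] that by simp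
    have "degree F = (\<Sum>z\<in>?R. order z (pderiv F)) + card ?R"
      unfolding deg[OF assms(1)] using ord by (simp add: sum_Suc)
    moreover have "degree (pderiv F) = (\<Sum>z\<in>?R. order z (pderiv F))"
      unfolding deg[OF ne'] using fin sub
      by (intro sum.mono_neutral_left) (auto simp: order_root)
    ultimately show False using two \<open>degree F \<noteq> 0\<close> by (simp add: degree_pderiv)
  qed
  then show ?thesis using that by blast
qed

text \<open>For a root of unity e^(2 pi i k / D), fixing l and having all r k integral for the
  exponents r of l are the same divisibility condition on k. Its solutions are the multiples of the
  index, which leaves D/N residues modulo D. Finite support makes convergence automatic.\<close>

lemma card_unity_stabiliser:
  assumes "D > 0" "psupp D l" "finite {r. pcoeff l r \<noteq> 0}"
  shows "card {\<theta>. \<theta> ^ D = 1 \<and> pconj D \<theta> l = l} * pindex l = D"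
proof -
  define ex where "ex r = nat \<lfloor>r * of_nat D\<rfloor>" for r :: rat
  define K where "K = {k. \<forall>r. pcoeff l r \<noteq> 0 \<longrightarrow> D dvd k * ex r}"
  have ex: "r = of_nat (ex r) / of_nat D" if nz: "pcoeff l r \<noteq> 0" for r
  proof -
    have "r * of_nat D \<in> \<nat>" using assms(2) nz by (simp add: psupp_def)
    then obtain n where "r = of_nat n / of_nat D" using assms(1) rat_Nats_cases by blast
    then show ?thesis using assms(1) by (simp add: ex_def)
  qed
  have ram: "l \<in> CPuiseux_ram k \<longleftrightarrow> k \<in> K" if "k > 0" for k
  proof -
    have "r * of_nat k \<in> \<nat> \<longleftrightarrow> D dvd k * ex r" if "pcoeff l r \<noteq> 0" for r
    proof -
      have "r * of_nat k \<in> \<nat> \<longleftrightarrow> (\<exists>n. (of_nat (k * ex r) :: rat) = of_nat (D * n))"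
        using assms(1) by (subst ex[OF that]) (auto simp: Nats_def image_iff field_simps)
      also have "\<dots> \<longleftrightarrow> D dvd k * ex r" by (simp only: of_nat_eq_iff dvd_def)
      finally show ?thesis .
    qed
    then have "psupp k l \<longleftrightarrow> k \<in> K" by (auto simp: psupp_def K_def)
    then show ?thesis
      using finite_support_CPuiseux_ram[OF \<open>k > 0\<close> _ assms(3)] CPuiseux_ram_imp_psupp by blast
  qed
  let ?N = "pindex l"
  have "D > 0 \<and> l \<in> CPuiseux_ram D" using assms finite_support_CPuiseux_ram by blast
  then have N: "?N > 0" "?N \<in> K"
    unfolding pindex_def using ram by (metis (mono_tags, lifting) LeastI)+
  have least: "k \<notin> K" if "0 < k" "k < ?N" for k
    using that not_less_Least[of k "\<lambda>N. N > 0 \<and> l \<in> CPuiseux_ram N"] ram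
    unfolding pindex_def by blast
  \<comment> \<open>K is closed under remainders modulo \<open>?N\<close>, and \<open>?N\<close> is
    its least positive element.\<close>
  have K: "k \<in> K \<longleftrightarrow> ?N dvd k" for k
  proof
    assume "k \<in> K"
    have "k mod ?N \<in> K"
      unfolding K_def
    proof clarify
      fix r assume r: "pcoeff l r \<noteq> 0"
      have "k * ex r = (k div ?N) * (?N * ex r) + (k mod ?N) * ex r"
        by (metis add_mult_distrib div_mult_mod_eq mult.assoc)
      moreover have "D dvd k * ex r" "D dvd ?N * ex r" using \<open>k \<in> K\<close> N r by (auto simp: K_def)
      ultimately show "D dvd (k mod ?N) * ex r" by (metis dvd_add_right_iff dvd_mult)
    qed
    then have "k mod ?N = 0" using least[of "k mod ?N"] N by auto
    then show "?N dvd k" by auto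
  next
    assume "?N dvd k"
    then obtain m where "k = m * ?N" by (metis dvdE mult.commute)
    then show "k \<in> K" using N by (simp add: K_def mult.assoc)
  qed
  have "D \<in> K" by (simp add: K_def)
  then obtain s where s: "D = ?N * s" using K by (auto elim: dvdE)
  have stab: "pconj D (unity_root D ^ k) l = l \<longleftrightarrow> k \<in> K" for k
  proof -
    have "pconj D (unity_root D ^ k) l = l \<longleftrightarrow>
        (\<forall>r. pcoeff l r \<noteq> 0 \<longrightarrow> (unity_root D ^ k) ^ ex r = 1)"
      by (auto simp: pcoeff_pconj ex_def intro!: puiseux_eqI) (metis mult_cancel_left1 pcoeff_pconj)
    then show ?thesis
      by (simp add: power_mult[symmetric] unity_root_power_eq_1_iff[OF assms(1)] K_def)
  qed
  have bij: "bij_betw (\<lambda>k. unity_root D ^ k) {..<D} {z. z ^ D = 1}"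
    by (rule bij_betw_unity_root[OF assms(1)])
  have "{\<theta>. \<theta> ^ D = 1 \<and> pconj D \<theta> l = l} = (\<lambda>k. unity_root D ^ k) ` {k \<in> {..<D}. ?N dvd k}"
  proof (intro equalityI subsetI)
    fix \<theta> assume "\<theta> \<in> {\<theta>. \<theta> ^ D = 1 \<and> pconj D \<theta> l = l}"
    moreover from this obtain k where "k < D" "\<theta> = unity_root D ^ k"
      using bij_betw_imp_surj_on[OF bij] by blast
    ultimately show "\<theta> \<in> (\<lambda>k. unity_root D ^ k) ` {k \<in> {..<D}. ?N dvd k}"
      using stab K by blast
  qed (use bij_betw_imp_surj_on[OF bij] stab K in blast)
  moreover have "inj_on (\<lambda>k. unity_root D ^ k) {k \<in> {..<D}. ?N dvd k}"
    using bij_betw_imp_inj_on[OF bij] by (rule inj_on_subset) auto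
  moreover have "{k \<in> {..<D}. ?N dvd k} = (\<lambda>m. ?N * m) ` {..<s}"
    using N s by (auto elim!: dvdE)
  then have "card {k \<in> {..<D}. ?N dvd k} = s"
    using N by (simp add: card_image inj_on_def)
  ultimately show ?thesis using s by (simp add: card_image mult.commute)
qed

section \<open>The orbit of a pseudo-ball\<close>

lemma proots_prod_linear:
  assumes "finite J"
  shows "proots (\<Prod>j\<in>J. [:- c j, 1:] :: complex poly) = image_mset c (mset_set J)"
  using assms by (induction J) (simp_all add: proots_mult del: mult_pCons_left)

text \<open>Equal products mean equal multisets of values, and both the filter and the factor depend
  on the value alone. No bijection between the index sets is exhibited.\<close>

lemma prod_filter_same_roots:
  fixes c :: "'i \<Rightarrow> complex" and d :: "'j \<Rightarrow> complex" and g :: "complex \<Rightarrow> 'a::comm_monoid_mult"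
  assumes "finite J" "finite K" "(\<Prod>j\<in>J. [:- c j, 1:]) = (\<Prod>i\<in>K. [:- d i, 1:])"
  shows "(\<Prod>j | j \<in> J \<and> P (c j). g (c j)) = (\<Prod>i | i \<in> K \<and> P (d i). g (d i))"
proof -
  have *: "(\<Prod>j | j \<in> S \<and> P (b j). g (b j)) =
      prod_mset (image_mset g (filter_mset P (image_mset b (mset_set S))))"
    if "finite S" for S and b :: "'k \<Rightarrow> complex"
    using that by (simp add: prod_unfold_prod_mset filter_mset_image_mset multiset.map_comp o_def)
  have "image_mset c (mset_set J) = image_mset d (mset_set K)"
    using arg_cong[OF assms(3), of proots] assms(1,2) by (simp add: proots_prod_linear)
  then show ?thesis using assms(1,2) by (simp add: *)
qed

lemma of_fps_monomial: "of_fps (fps_const c * fps_X ^ L) = pmonom c (of_nat L)"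
proof (rule puiseux_eqI)
  fix r :: rat
  show "pcoeff (of_fps (fps_const c * fps_X ^ L)) r = pcoeff (pmonom c (of_nat L)) r"
  proof (cases "r \<in> \<nat>")
    case True
    then obtain n where r: "r = of_nat n" by (auto elim: Nats_cases)
    have "pcoeff (of_fps (fps_const c * fps_X ^ L)) r = fps_nth (fps_const c * fps_X ^ L) n"
      using pcoeff_ramify_of_nat[of 1 _ n] by (simp add: of_fps_def r)
    then show ?thesis by (simp add: r)
  next
    case False
    then have "r \<noteq> of_nat L" by auto
    moreover have "pcoeff (of_fps (fps_const c * fps_X ^ L)) r = 0"
      using False by (simp add: of_fps_def pcoeff_ramify_0)
    ultimately show ?thesis by simp
  qed
qed

context factored_germ
begin

text \<open>\<open>ball_orbit\<close> admits every centre of the ball in \<open>Zer f\<close>. Two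
  centres agree below h, and so do their conjugates, so one fixed centre yields the whole
  orbit.\<close>

lemma ball_orbit_eq:
  assumes "branching a h"
  shows "ball_orbit D f (pball a h) = (\<lambda>\<theta>. pball (pconj D \<theta> a) h) ` {\<theta>. \<theta> ^ D = 1}"
proof
  note a = branching_CPuiseux[OF assms] and h = branching_pos[OF assms]
  show "ball_orbit D f (pball a h) \<subseteq> (\<lambda>\<theta>. pball (pconj D \<theta> a) h) ` {\<theta>. \<theta> ^ D = 1}"
  proof
    fix B' assume "B' \<in> ball_orbit D f (pball a h)"
    then obtain \<theta> a' k where B': "B' = pball (pconj D \<theta> a') k" "\<theta> ^ D = 1" "a' \<in> Zer f" "k > 0"
      "pball a h = pball a' k" by (auto simp: ball_orbit_def)
    then have [simp]: "k = h" using height_pball a h Zer_CPuiseux by metis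
    have "\<forall>r<h. pcoeff a r = pcoeff a' r"
      using B'(3,5) a Zer_CPuiseux by (simp add: pball_eq_iff)
    then have "pball (pconj D \<theta> a') h = pball (pconj D \<theta> a) h"
      by (auto simp: mem_pball pcoeff_pconj)
    with B' show "B' \<in> (\<lambda>\<theta>. pball (pconj D \<theta> a) h) ` {\<theta>. \<theta> ^ D = 1}" by auto
  qed
  show "(\<lambda>\<theta>. pball (pconj D \<theta> a) h) ` {\<theta>. \<theta> ^ D = 1} \<subseteq> ball_orbit D f (pball a h)"
    using branching_Zer[OF assms] h unfolding ball_orbit_def by blast
qed

text \<open>The fibres of $\theta\mapsto\theta*B$ are the cosets of the stabiliser of $\lambda_B$.\<close>

lemma prod_over_orbit:
  fixes g :: "puiseux set \<Rightarrow> 'b::comm_semiring_1"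
  assumes "branching a h"
  shows "(\<Prod>\<theta> | \<theta> ^ D = 1. g (pball (pconj D \<theta> a) h)) =
    (\<Prod>B'\<in>ball_orbit D f (pball a h). g B') ^
      card {\<theta>. \<theta> ^ D = 1 \<and> pconj D \<theta> (lambda (pball a h)) = lambda (pball a h)}"
proof -
  let ?U = "{\<theta>::complex. \<theta> ^ D = 1}" and ?B = "\<lambda>\<theta>. pball (pconj D \<theta> a) h"
  let ?l = "prestrict {..<h} a"
  let ?H = "{\<theta>. \<theta> ^ D = 1 \<and> pconj D \<theta> ?l = ?l}"
  have l: "lambda (pball a h) = ?l"
    by (rule lambda_pball[OF branching_CPuiseux[OF assms] branching_pos[OF assms]])
  have finU: "finite ?U" using D_pos by (intro finite_roots_unity) simp
  have eq: "?B \<eta> = ?B \<theta> \<longleftrightarrow> pconj D \<eta> ?l = pconj D \<theta> ?l" if "\<eta> \<in> ?U" "\<theta> \<in> ?U" for \<eta> \<theta>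
    using that branching_CPuiseux[OF branching_pconj[OF _ assms]]
    by (simp add: pball_eq_iff pconj_prestrict prestrict_eq_iff)
  have fibre: "card {\<eta> \<in> ?U. ?B \<eta> = ?B \<theta>} = card ?H" if \<theta>: "\<theta> \<in> ?U" for \<theta>
  proof -
    have nz: "\<theta> \<noteq> 0" using \<theta> root_of_unity_nonzero by simp
    have "bij_betw (\<lambda>\<eta>. \<eta> * \<theta>) ?H {\<eta> \<in> ?U. ?B \<eta> = ?B \<theta>}"
    proof (rule bij_betw_byWitness[where f' = "\<lambda>\<eta>. \<eta> / \<theta>"])
      show "(\<lambda>\<eta>. \<eta> * \<theta>) ` ?H \<subseteq> {\<eta> \<in> ?U. ?B \<eta> = ?B \<theta>}"
      proof (rule image_subsetI)
        fix \<eta> assume "\<eta> \<in> ?H"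
        then have \<eta>: "\<eta> ^ D = 1" "pconj D \<eta> ?l = ?l" by auto
        then have U: "\<eta> * \<theta> \<in> ?U" using \<theta> by (simp add: power_mult_distrib)
        have "pconj D (\<eta> * \<theta>) ?l = pconj D \<theta> ?l"
          using \<eta>(2) by (metis pconj_pconj mult.commute)
        then show "\<eta> * \<theta> \<in> {\<eta> \<in> ?U. ?B \<eta> = ?B \<theta>}" using eq[OF U \<theta>] U by blast
      qed
      show "(\<lambda>\<eta>. \<eta> / \<theta>) ` {\<eta> \<in> ?U. ?B \<eta> = ?B \<theta>} \<subseteq> ?H"
      proof (rule image_subsetI)
        fix \<eta> assume "\<eta> \<in> {\<eta> \<in> ?U. ?B \<eta> = ?B \<theta>}"
        then have \<eta>: "\<eta> ^ D = 1" "?B \<eta> = ?B \<theta>" by auto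
        then have "pconj D \<eta> ?l = pconj D \<theta> ?l" using eq \<theta> by simp
        then have "pconj D (1 / \<theta>) (pconj D \<eta> ?l) = ?l" using nz by (simp add: pconj_pconj)
        then show "\<eta> / \<theta> \<in> ?H"
          using \<eta> \<theta> by (simp add: pconj_pconj power_divide)
      qed
    qed (use nz in auto)
    then show ?thesis by (rule bij_betw_same_card[symmetric])
  qed
  have "(\<Prod>\<theta>\<in>?U. g (?B \<theta>)) = (\<Prod>B'\<in>?B ` ?U. \<Prod>\<theta> | \<theta> \<in> ?U \<and> ?B \<theta> = B'. g (?B \<theta>))"
    using finU by (rule prod.image_gen)
  also have "\<dots> = (\<Prod>B'\<in>?B ` ?U. g B' ^ card ?H)"
  proof (rule prod.cong[OF refl])
    fix B' assume "B' \<in> ?B ` ?U"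
    then obtain \<theta> where \<theta>: "\<theta> \<in> ?U" "B' = ?B \<theta>" by blast
    have "(\<Prod>\<eta> | \<eta> \<in> ?U \<and> ?B \<eta> = B'. g (?B \<eta>)) = (\<Prod>\<eta> | \<eta> \<in> ?U \<and> ?B \<eta> = B'. g B')"
      by (rule prod.cong) auto
    also have "\<dots> = g B' ^ card ?H"
      using fibre[OF \<theta>(1)] \<theta>(2) by (simp only: prod_constant)
    finally show "(\<Prod>\<eta> | \<eta> \<in> ?U \<and> ?B \<eta> = B'. g (?B \<eta>)) = g B' ^ card ?H" .
  qed
  finally show ?thesis unfolding ball_orbit_eq[OF assms] l prod_power_distrib .
qed

text \<open>Differentiate G(\<kappa> z) = \<mu> F(z), where G belongs to the conjugate ball: the
  critical points of G are those of F times \<kappa>.\<close>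

lemma pderiv_FB_pconj:
  assumes "branching a h" "\<theta> ^ D = 1" "C \<noteq> 0" "finite K"
    and "pderiv (FB f (pball a h)) = smult C (\<Prod>i\<in>K. [:- z i, 1:])"
  obtains k where "k \<noteq> 0" "pderiv (FB f (pball (pconj D \<theta> a) h)) =
    smult k (\<Prod>i\<in>K. [:- (\<theta> ^ nat \<lfloor>h * of_nat D\<rfloor> * z i), 1:])"
proof -
  let ?F = "FB f (pball a h)" and ?G = "FB f (pball (pconj D \<theta> a) h)"
  define \<kappa> where "\<kappa> = \<theta> ^ nat \<lfloor>h * of_nat D\<rfloor>"
  define \<mu> where "\<mu> = \<theta> ^ nat \<lfloor>qB f (pball a h) * of_nat D\<rfloor>"
  \<comment> \<open>One \<kappa> comes from the chain rule, the power from rescaling the linear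
    factors.\<close>
  define k where "k = \<mu> * C / (\<kappa> * \<kappa> ^ card K)"
  have nz: "\<kappa> \<noteq> 0" "\<mu> \<noteq> 0" using root_of_unity_nonzero[OF assms(2)] by (simp_all add: \<kappa>_def \<mu>_def)
  have "poly (pcompose ?G [:0, \<kappa>:]) x = poly (smult \<mu> ?F) x" for x
    using FB_pconj(2)[OF assms(1,2), of x] by (simp add: poly_pcompose \<kappa>_def \<mu>_def mult.commute)
  then have "pcompose ?G [:0, \<kappa>:] = smult \<mu> ?F" by (simp add: poly_eq_poly_eq_iff[symmetric] fun_eq_iff)
  from arg_cong[OF this, of pderiv]
  have "pcompose (pderiv ?G) [:0, \<kappa>:] * [:\<kappa>:] = smult (\<mu> * C) (\<Prod>i\<in>K. [:- z i, 1:])"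
    by (simp add: pderiv_pcompose pderiv_smult pderiv_pCons assms(5))
  from arg_cong[OF this, of poly]
  have G: "poly (pderiv ?G) (\<kappa> * x) * \<kappa> = \<mu> * C * (\<Prod>i\<in>K. x - z i)" for x
    by (auto simp: fun_eq_iff poly_pcompose poly_prod mult_ac)
  have "poly (pderiv ?G) y = poly (smult k (\<Prod>i\<in>K. [:- (\<kappa> * z i), 1:])) y" for y
  proof -
    have "(\<Prod>i\<in>K. y - \<kappa> * z i) = (\<Prod>i\<in>K. \<kappa> * (y / \<kappa> - z i))"
      using nz by (intro prod.cong) (auto simp: algebra_simps)
    also have "\<dots> = \<kappa> ^ card K * (\<Prod>i\<in>K. y / \<kappa> - z i)" by (simp add: prod.distrib)
    finally have P: "(\<Prod>i\<in>K. y - \<kappa> * z i) = \<kappa> ^ card K * (\<Prod>i\<in>K. y / \<kappa> - z i)" .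
    show ?thesis using G[of "y / \<kappa>"] nz by (simp add: k_def poly_prod P field_simps)
  qed
  then have "pderiv ?G = smult k (\<Prod>i\<in>K. [:- (\<kappa> * z i), 1:])"
    by (simp add: poly_eq_poly_eq_iff[symmetric] fun_eq_iff)
  moreover have "k \<noteq> 0" using nz assms(3) by (simp add: k_def)
  ultimately show ?thesis using that by (simp add: \<kappa>_def)
qed

text \<open>The derivative of \<open>FB\<close> on the conjugate ball has two factorisations, with
  equal constants by comparing leading coefficients. The multiset comparison then replaces the
  coefficients of the \<open>\<gamma> j\<close> by the rotated z_i, where \<open>FB_pconj\<close>
  gives the values.\<close>

lemma prod_leaving_values:
  assumes "branching a h" "\<theta> ^ D = 1" "C \<noteq> 0" "finite K" "finite A" "unit_C2 e'"
    and "pderiv (FB f (pball a h)) = smult C (\<Prod>i\<in>K. [:- z i, 1:])"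
    and "\<And>j. j \<in> A \<Longrightarrow> \<gamma> j \<in> frac_series"
    and "lift_y (fps_deriv f) = lift_y e' * (\<Prod>j\<in>A. fps_X - fps_const (\<gamma> j))"
  shows "(\<Prod>j | j \<in> A \<and> leaves_at f (\<gamma> j) (pball (pconj D \<theta> a) h).
      [:- poly (FB f (pball (pconj D \<theta> a) h)) (pcoeff (\<gamma> j) h), 1:]) =
    (\<Prod>i | i \<in> K \<and> poly (FB f (pball a h)) (z i) \<noteq> 0.
      [:- (\<theta> ^ nat \<lfloor>qB f (pball a h) * of_nat D\<rfloor> * poly (FB f (pball a h)) (z i)), 1:])"
proof -
  let ?a = "pconj D \<theta> a"
  let ?G = "FB f (pball ?a h)" and ?\<kappa> = "\<theta> ^ nat \<lfloor>h * of_nat D\<rfloor>"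
  let ?J = "{j. j \<in> A \<and> \<gamma> j \<in> pball ?a h}"
  note br = branching_pconj[OF assms(2,1)]
  obtain k where k: "k \<noteq> 0" "pderiv ?G = smult k (\<Prod>j\<in>?J. [:- pcoeff (\<gamma> j) h, 1:])"
    using pderiv_FB_factored[OF br assms(6,5,8,9)] by blast
  obtain k' where k': "k' \<noteq> 0" "pderiv ?G = smult k' (\<Prod>i\<in>K. [:- (?\<kappa> * z i), 1:])"
    using pderiv_FB_pconj[OF assms(1-4,7)] by blast
  have "lead_coeff (pderiv ?G) = k" unfolding k(2) by (simp add: lead_coeff_prod)
  moreover have "lead_coeff (pderiv ?G) = k'" unfolding k'(2) by (simp add: lead_coeff_prod)
  ultimately have "k = k'" by simp
  have "smult k (\<Prod>j\<in>?J. [:- pcoeff (\<gamma> j) h, 1:]) = smult k (\<Prod>i\<in>K. [:- (?\<kappa> * z i), 1:])"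
    unfolding k(2)[symmetric] unfolding k'(2) \<open>k = k'\<close> ..
  then have "(\<Prod>j\<in>?J. [:- pcoeff (\<gamma> j) h, 1:]) = (\<Prod>i\<in>K. [:- (?\<kappa> * z i), 1:])"
    using smult_cancel[OF k(1)] by blast
  from prod_filter_same_roots[OF _ assms(4) this,
      where P = "\<lambda>c. poly ?G c \<noteq> 0" and g = "\<lambda>c. [:- poly ?G c, 1:]"]
  have "(\<Prod>j | j \<in> ?J \<and> poly ?G (pcoeff (\<gamma> j) h) \<noteq> 0. [:- poly ?G (pcoeff (\<gamma> j) h), 1:]) =
      (\<Prod>i | i \<in> K \<and> poly ?G (?\<kappa> * z i) \<noteq> 0. [:- poly ?G (?\<kappa> * z i), 1:])"
    using assms(5) by simp
  moreover have "{j. j \<in> ?J \<and> poly ?G (pcoeff (\<gamma> j) h) \<noteq> 0} =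
      {j. j \<in> A \<and> leaves_at f (\<gamma> j) (pball ?a h)}"
    using assms(8) leaves_at_iff[OF br] by (auto simp: frac_series_iff)
  ultimately show ?thesis
    using root_of_unity_nonzero[OF assms(2)] by (simp add: FB_pconj(2)[OF assms(1,2)])
qed

end

theorem proposition3p8:
  fixes f e e' :: "complex fps fps"
    and \<alpha> \<gamma> :: "nat \<Rightarrow> puiseux"
    and B :: "puiseux set"
    and p D L M N l :: nat
    and C' :: complex and z w :: "nat \<Rightarrow> complex" and I :: "nat set"
  assumes "f \<in> C2" and "reduced_C2 f"
    and "fps_nth (fps_nth f 0) 0 = 0"
    and "\<exists>j. fps_nth (fps_nth f j) 0 \<noteq> 0"
    and "unit_C2 e" and "\<And>i. i \<in> {1..p} \<Longrightarrow> \<alpha> i \<in> frac_series" and "inj_on \<alpha> {1..p}"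
    and "lift_y f = lift_y e * (\<Prod>i=1..p. fps_X - fps_const (\<alpha> i))"
    and "unit_C2 e'" and "\<And>j. j \<in> {1..p-1} \<Longrightarrow> \<gamma> j \<in> frac_series"
    and "lift_y (fps_deriv f) = lift_y e' * (\<Prod>j=1..p-1. fps_X - fps_const (\<gamma> j))"
    and "D > 0"
    and "\<And>i. i \<in> {1..p} \<Longrightarrow> \<alpha> i \<in> CPuiseux_ram D"
    and "\<And>j. j \<in> {1..p-1} \<Longrightarrow> \<gamma> j \<in> CPuiseux_ram D"
    and "B \<in> Tree f"
    and "L > 0" and "M > 0" and "coprime L M" and "qB f B = of_nat L / of_nat M"
    and "N = pindex (lambda B)"
    and "C' \<noteq> 0" and "pderiv (FB f B) = smult C' (\<Prod>i=1..l. [:- z i, 1:])"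
    and "\<And>i. i \<in> {1..l} \<Longrightarrow> w i = poly (FB f B) (z i)"
    and "I = {i \<in> {1..l}. w i \<noteq> 0}"
  shows "lead_coeff (newton_initial (disc_orbit D f (p - 1) \<gamma> B)) = 1 \<and>
    newton_initial (disc_orbit D f (p - 1) \<gamma> B) ^ M =
      (\<Prod>i\<in>I. (monom 1 M - [: of_fps (fps_const (w i ^ M) * fps_X ^ L) :]) ^ N)"
proof -
  interpret factored_germ f e \<alpha> p D
    using assms(5,6,8,12) CPuiseux_ram_imp_psupp[OF assms(13)] by unfold_locales auto
  obtain a h where br: "branching a h" and B: "B = pball a h"
    using \<open>B \<in> Tree f\<close> Tree_iff by blast
  let ?q = "qB f B" and ?U = "{\<theta>::complex. \<theta> ^ D = 1}"
  let ?B = "\<lambda>\<theta>. pball (pconj D \<theta> a) h" and ?O = "ball_orbit D f B"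
  have q: "?q > 0" using assms(16,17,19) by simp
  obtain n where "?q * of_nat D = of_nat n" using qB_psupp[OF br] B by (auto elim: Nats_cases)
  \<comment> \<open>From q D = n with q = L/M one gets L D = n M, and coprimality gives M dvd
    D.\<close>
  then have "(of_nat (L * D) :: rat) = of_nat (n * M)" using assms(17,19) by (simp add: field_simps)
  then have "L * D = n * M" by (simp only: of_nat_eq_iff)
  then have "M dvd D" using assms(18) by (metis coprime_commute coprime_dvd_mult_right_iff dvd_triv_right)
  then obtain s where s: "D = M * s" by (elim dvdE)
  have "s > 0" using s assms(12) by simp
  have qD: "nat \<lfloor>?q * of_nat D\<rfloor> = L * s"
  proof -
    have "?q * of_nat D = of_nat (L * s)" using assms(17,19) s by simp
    then show ?thesis by (simp only: floor_of_nat nat_int)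
  qed

  define leaving where "leaving B' = {j. j \<in> {1..p-1} \<and> leaves_at f (\<gamma> j) B'}" for B'
  define val where "val B' j = poly (FB f B') (pcoeff (\<gamma> j) h)" for B' j
  define A where "A B' = (\<Prod>j\<in>leaving B'. [:- val B' j, 1:])" for B'
  have A: "A (?B \<theta>) = (\<Prod>i\<in>I. [:- (\<theta> ^ (L * s) * w i), 1:])" if "\<theta> \<in> ?U" for \<theta>
  proof -
    have "A (?B \<theta>) = (\<Prod>i | i \<in> {1..l} \<and> poly (FB f B) (z i) \<noteq> 0.
        [:- (\<theta> ^ (L * s) * poly (FB f B) (z i)), 1:])"
      using prod_leaving_values[OF br _ assms(21) finite_atLeastAtMost finite_atLeastAtMost assms(9)
          assms(22)[unfolded B] assms(10,11), of \<theta>] that qD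
      unfolding A_def leaving_def val_def B by simp
    also have "\<dots> = (\<Prod>i\<in>I. [:- (\<theta> ^ (L * s) * w i), 1:])"
      using assms(23,24) by (intro prod.cong) auto
    finally show ?thesis .
  qed
  have orbit: "?O = ?B ` ?U" unfolding B by (rule ball_orbit_eq[OF br])
  have finU: "finite ?U" using assms(12) by (intro finite_roots_unity) simp
  have finO: "finite ?O" unfolding orbit using finU by simp

  \<comment> \<open>An empty product would have no compact edge, so a critical point of
    \<open>FB\<close> that is not one of its roots is needed.\<close>
  have "I \<noteq> {}"
  proof -
    obtain c d where "c \<noteq> d" "poly (FB f B) c = 0" "poly (FB f B) d = 0"
      using FB_two_roots[OF br] B by blast
    then obtain x where "poly (pderiv (FB f B)) x = 0" "poly (FB f B) x \<noteq> 0"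
      using exists_critical_nonroot[of "FB f B" c d] FB_nonzero[OF br] B by blast
    then have "\<exists>i\<in>{1..l}. w i \<noteq> 0" using assms(21,22,23) by (auto simp: poly_prod)
    then show ?thesis using assms(24) by blast
  qed
  \<comment> \<open>Conjugation by \<theta> = 1 shows that the roots leaving at B give a polynomial
    of degree card I, which is positive.\<close>
  have "leaving B \<noteq> {}"
  proof
    assume "leaving B = {}"
    then have "A (?B 1) = 1" by (simp add: A_def B)
    with A[of 1] have "(\<Prod>i\<in>I. [:- w i, 1:]) = (1 :: complex poly)" by simp
    from arg_cong[OF this, of degree] have "card I = 0" by (simp add: degree_prod_eq_sum_degree)
    moreover have "finite I" unfolding assms(24) by simp
    ultimately show False using \<open>I \<noteq> {}\<close> by simp
  qed
  moreover have "?B 1 \<in> ?O" unfolding orbit by (rule imageI) simp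
  then have "B \<in> ?O" by (simp add: B)
  ultimately have ne: "Sigma ?O leaving \<noteq> {}" by blast
  have fin: "finite (leaving B')" for B' by (simp add: leaving_def)
  have start: "starts_with (psubst f (\<gamma> j)) (val B' j) ?q \<and> val B' j \<noteq> 0"
    if "B' \<in> ?O" "j \<in> leaving B'" for B' j
  proof -
    from that(1) obtain \<theta> where \<theta>: "\<theta> \<in> ?U" "B' = ?B \<theta>" unfolding orbit by blast
    then have br': "branching (pconj D \<theta> a) h" using branching_pconj br by simp
    have "\<gamma> j \<in> CPuiseux" using that(2) assms(10) by (simp add: leaving_def frac_series_iff)
    then show ?thesis
      using that(2) leaves_at_iff[OF br'] starts_with_FB_pball[OF br', of "\<gamma> j"] \<theta> FB_pconj(1)[OF br, of \<theta>]
      by (simp add: leaving_def val_def B)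
  qed
  \<comment> \<open>The double product becomes one family of linear factors indexed by pairs (ball,
    root), all with the same exponent q, so a single Newton diagram has to be computed.\<close>
  have "disc_orbit D f (p - 1) \<gamma> B = (\<Prod>x\<in>Sigma ?O leaving. [:- psubst f (\<gamma> (snd x)), 1:])"
    unfolding disc_orbit_def disc_factor_def leaving_def
    using finO by (subst prod.Sigma) (auto simp: case_prod_beta)
  also have "newton_initial \<dots> = homogenize ?q (\<Prod>x\<in>Sigma ?O leaving. [:- val (fst x) (snd x), 1:])"
    using finO fin ne q start by (intro newton_initial_prod_linear) auto
  also have "(\<Prod>x\<in>Sigma ?O leaving. [:- val (fst x) (snd x), 1:]) = (\<Prod>B'\<in>?O. A B')"
    unfolding A_def using finO fin by (subst prod.Sigma) (auto simp: case_prod_beta)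
  finally have init: "newton_initial (disc_orbit D f (p - 1) \<gamma> B) = homogenize ?q (\<Prod>B'\<in>?O. A B')" .
  have lead: "lead_coeff (\<Prod>B'\<in>?O. A B') = 1" by (simp add: A_def lead_coeff_prod)

  \<comment> \<open>The claim at u = 1: the product of the \<open>A B'\<close> over the orbit has to
    equal S^(N/M) in the sense of M-th powers.\<close>
  define S where "S = (\<Prod>i\<in>I. monom 1 M - [:w i ^ M:])"
  have leadS: "lead_coeff S = 1"
    using assms(17) by (auto simp: S_def lead_coeff_prod degree_monom_minus_const coeff_pCons
        split: nat.splits intro!: prod.neutral)
  let ?H = "card {\<theta>. \<theta> ^ D = 1 \<and> pconj D \<theta> (lambda B) = lambda B}"
  have lam: "lambda B = prestrict {..<h} a"
    unfolding B by (rule lambda_pball[OF branching_CPuiseux[OF br] branching_pos[OF br]])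
  have "finite {r. pcoeff (lambda B) r \<noteq> 0}"
    by (rule finite_subset[OF _ finite_pcoeff_le[of a h]]) (auto simp: lam)
  then have card: "?H * N = D"
    using assms(12,20) card_unity_stabiliser[of D "lambda B"] Zer_psupp[OF branching_Zer[OF br]]
    by (simp add: lam psupp_prestrict)
  have "(\<Prod>B'\<in>?O. A B') ^ ?H = (\<Prod>\<theta>\<in>?U. A (?B \<theta>))"
    unfolding B by (rule prod_over_orbit[OF br, symmetric])
  also have "\<dots> = (\<Prod>\<theta>\<in>?U. \<Prod>i\<in>I. [:- (\<theta> ^ (L * s) * w i), 1:])"
    using A by (intro prod.cong) auto
  also have "\<dots> = (\<Prod>i\<in>I. \<Prod>\<theta>\<in>?U. [:- (\<theta> ^ (L * s) * w i), 1:])"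
    by (rule prod.swap)
  also have "\<dots> = S ^ s"
    unfolding S_def prod_power_distrib
    using assms(17,18,24) \<open>s > 0\<close> by (intro prod.cong refl) (simp add: s prod_linear_unity_powers)
  \<comment> \<open>Raising to the power N turns the multiplicity D/N of each ball into D = M s, so
    both sides become s-th powers.\<close>
  finally have "(\<Prod>B'\<in>?O. A B') ^ (?H * N) = S ^ (s * N)" by (simp only: power_mult)
  then have "(\<Prod>B'\<in>?O. A B') ^ D = S ^ (s * N)" unfolding card .
  moreover have "(\<Prod>B'\<in>?O. A B') ^ D = ((\<Prod>B'\<in>?O. A B') ^ M) ^ s"
    unfolding power_mult[symmetric] using s by simp
  ultimately have pow: "((\<Prod>B'\<in>?O. A B') ^ M) ^ s = (S ^ N) ^ s"
    by (simp add: power_mult[symmetric] mult.commute)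
  have key: "(\<Prod>B'\<in>?O. A B') ^ M = S ^ N"
  proof (rule monic_power_eq[OF _ _ pow \<open>s > 0\<close>])
    show "lead_coeff ((\<Prod>B'\<in>?O. A B') ^ M) = 1" unfolding lead_coeff_power lead by simp
    show "lead_coeff (S ^ N) = 1" unfolding lead_coeff_power leadS by simp
  qed

  have "newton_initial (disc_orbit D f (p - 1) \<gamma> B) ^ M = homogenize ?q (S ^ N)"
    unfolding init using lead q by (subst homogenize_power[symmetric]) (auto simp: key)
  also have "\<dots> = homogenize ?q S ^ N"
    using leadS q by (intro homogenize_power) auto
  also have "homogenize ?q S = (\<Prod>i\<in>I. monom 1 M - [:of_fps (fps_const (w i ^ M) * fps_X ^ L):])"
  proof -
    have "monom 1 M - [:w i ^ M:] \<noteq> 0" for i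
      using degree_monom_minus_const[OF assms(17), of "w i ^ M"] assms(17) by force
    \<comment> \<open>Here the rational weight becomes integral: the constant w_i^M receives the
      exponent M q = L of u.\<close>
    moreover have "of_nat M * ?q = of_nat L" using assms(17,19) by simp
    ultimately show ?thesis
      unfolding S_def using q assms(17)
      by (simp add: homogenize_prod homogenize_monom_minus_const of_fps_monomial)
  qed
  finally have "newton_initial (disc_orbit D f (p - 1) \<gamma> B) ^ M =
      (\<Prod>i\<in>I. (monom 1 M - [: of_fps (fps_const (w i ^ M) * fps_X ^ L) :]) ^ N)"
    unfolding prod_power_distrib .
  moreover have "lead_coeff (newton_initial (disc_orbit D f (p - 1) \<gamma> B)) = 1"
    unfolding init by (rule lead_coeff_homogenize[OF lead])
  ultimately show ?thesis by blast
qed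

end
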